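(* Suppose $G$ is a bipartite graph with $n$ vertices and $m$ edges. Let $q \in \mathbb{N}$. If $q \geq m + 2^m$ and, for each $i$, $a_i$ is the number of acyclic spanning subgraphs of $G$ with exactly $i$ components, then \[ P_{DP}(G,q) = \sum_{j=0}^{n-1}(-1)^j a_{n-j}\, q^{n-j}. \]
   Context: All graphs are nonempty (at least one vertex), finite and simple, and $\mathbb{N}=\{1,2,3,\dots\}$. A spanning subgraph of $G$ is a subgraph with vertex set $V(G)$ (so spanning subgraphs correspond to subsets of $E(G)$). For a graph $H$ and $S,U\subseteq V(H)$, $E_H(S,U)$ is the set of edges of $H$ with one endpoint in $S$ and the other in $U$. A cover of a graph $G$ is a pair $\mathcal{H}=(L,H)$ where $H$ is a graph and $L$ assigns to each $v\in V(G)$ a set $L(v)\subseteq V(H)$ such that: the sets $L(v)$, $v\in V(G)$, are pairwise disjoint, each $L(v)$ is an independent set in $H$, and $V(H)=\bigcup_{v\in V(G)}L(v)$; and for all distinct $u,v\in V(G)$, $E_H(L(u),L(v))$ is a matching (not necessarily perfect, possibly empty), which is empty whenever $uv\notin E(G)$. For $q\in\mathbb{N}$, the cover is $q$-fold if $|L(v)|=q$ for every $v\in V(G)$. A proper $\mathcal{H}$-coloring of $G$ is a set $T\subseteq V(H)$ with $|T\cap L(v)|=1$ for every $v\in V(G)$ that is independent in $H$. $P_{DP}(G,\mathcal{H})$ denotes the number of proper $\mathcal{H}$-colorings of $G$. The DP color function $P_{DP}(G,q)$ is the minimum of $P_{DP}(G,\mathcal{H})$ over all $q$-fold covers $\mathcal{H}$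 of $G$. *)

theory Defs
  imports "HOL-Library.Disjoint_Sets"
begin

section \<open>Finite simple graphs\<close>

record 'a ugraph =
  verts :: "'a set"
  edges :: "'a set set"

definition simple_graph :: "'a ugraph \<Rightarrow> bool" where
  "simple_graph G \<longleftrightarrow> finite (verts G) \<and> verts G \<noteq> {} \<and>
     (\<forall>e\<in>edges G. e \<subseteq> verts G \<and> card e = 2)"

text \<open>A part of the bipartition may be empty, so edgeless graphs, including the
  one-vertex graph, are bipartite.\<close>

definition bipartite :: "'a ugraph \<Rightarrow> bool" where
  "bipartite G \<longleftrightarrow> (\<exists>A B. A \<union> B = verts G \<and> A \<inter> B = {} \<and>
     (\<forall>e\<in>edges G. \<exists>a\<in>A. \<exists>b\<in>B. e = {a, b}))"

definition independent :: "'a ugraph \<Rightarrow> 'a set \<Rightarrow> bool" where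
  "independent G S \<longleftrightarrow> S \<subseteq> verts G \<and> (\<forall>x\<in>S. \<forall>y\<in>S. {x, y} \<notin> edges G)"

definition edges_between :: "'a ugraph \<Rightarrow> 'a set \<Rightarrow> 'a set \<Rightarrow> 'a set set" where
  "edges_between G S U = {e \<in> edges G. \<exists>s\<in>S. \<exists>u\<in>U. e = {s, u}}"

definition spanning_subgraph :: "'a ugraph \<Rightarrow> 'a ugraph \<Rightarrow> bool" where
  "spanning_subgraph S G \<longleftrightarrow> verts S = verts G \<and> edges S \<subseteq> edges G"

text \<open>A cycle is given by the list of its vertices, without repeating the first one.\<close>

definition cycle :: "'a ugraph \<Rightarrow> 'a list \<Rightarrow> bool" where
  "cycle G vs \<longleftrightarrow> 3 \<le> length vs \<and> distinct vs \<and>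
     (\<forall>i<length vs. {vs ! i, vs ! (Suc i mod length vs)} \<in> edges G)"

definition acyclic_graph :: "'a ugraph \<Rightarrow> bool" where
  "acyclic_graph G \<longleftrightarrow> (\<nexists>vs. cycle G vs)"

definition connected_in :: "'a ugraph \<Rightarrow> ('a \<times> 'a) set" where
  "connected_in G = {(x, y). x \<in> verts G \<and> y \<in> verts G \<and>
     (x, y) \<in> {(u, v). {u, v} \<in> edges G}\<^sup>*}"

text \<open>Each component is represented by its vertex set.\<close>

definition components :: "'a ugraph \<Rightarrow> 'a set set" where
  "components G = verts G // connected_in G"


section \<open>Covers and DP colorings\<close>

text \<open>Values of \<open>L\<close> outside \<open>verts G\<close> are irrelevant. A matching is a set of pairwise
  disjoint edges.\<close>

definition is_cover :: "'a ugraph \<Rightarrow> ('a \<Rightarrow> 'b set) \<Rightarrow> 'b ugraph \<Rightarrow> bool" where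
  "is_cover G L H \<longleftrightarrow> simple_graph H \<and>
     disjoint_family_on L (verts G) \<and>
     (\<forall>v\<in>verts G. independent H (L v)) \<and>
     verts H = (\<Union>v\<in>verts G. L v) \<and>
     (\<forall>u\<in>verts G. \<forall>v\<in>verts G. u \<noteq> v \<longrightarrow>
        disjoint (edges_between H (L u) (L v)) \<and>
        ({u, v} \<notin> edges G \<longrightarrow> edges_between H (L u) (L v) = {}))"

definition is_fold_cover :: "nat \<Rightarrow> 'a ugraph \<Rightarrow> ('a \<Rightarrow> 'b set) \<Rightarrow> 'b ugraph \<Rightarrow> bool" where
  "is_fold_cover q G L H \<longleftrightarrow> is_cover G L H \<and> (\<forall>v\<in>verts G. card (L v) = q)"

definition proper_coloring ::
  "'a ugraph \<Rightarrow> ('a \<Rightarrow> 'b set) \<Rightarrow> 'b ugraph \<Rightarrow> 'b set \<Rightarrow> bool" where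
  "proper_coloring G L H T \<longleftrightarrow> T \<subseteq> verts H \<and>
     (\<forall>v\<in>verts G. card (T \<inter> L v) = 1) \<and> independent H T"

definition num_colorings :: "'a ugraph \<Rightarrow> ('a \<Rightarrow> 'b set) \<Rightarrow> 'b ugraph \<Rightarrow> nat" where
  "num_colorings G L H = card {T. proper_coloring G L H T}"

text \<open>Cover graphs are finite, so up to isomorphism all of them have vertices of type
  \<^typ>\<open>nat\<close>; the lemmas \<open>DP_color_function_le\<close> and \<open>DP_color_function_attained\<close> below show
  that the resulting number is the minimum over covers with vertices of arbitrary type.\<close>

definition DP_color_function :: "'a ugraph \<Rightarrow> nat \<Rightarrow> nat" where
  "DP_color_function G q =
     (LEAST k. \<exists>(L :: 'a \<Rightarrow> nat set) H. is_fold_cover q G L H \<and> k = num_colorings G L H)"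

definition relabel :: "('b \<Rightarrow> 'c) \<Rightarrow> 'b ugraph \<Rightarrow> 'c ugraph" where
  "relabel f H = \<lparr>verts = f ` verts H, edges = (`) f ` edges H\<rparr>"

lemma relabel_edge_iff:
  assumes f: "inj_on f (verts H)" and H: "simple_graph H"
    and e: "e \<subseteq> verts H"
  shows "f ` e \<in> edges (relabel f H) \<longleftrightarrow> e \<in> edges H"
proof
  assume "f ` e \<in> edges (relabel f H)"
  then obtain e' where e': "e' \<in> edges H" "f ` e = f ` e'" by (auto simp: relabel_def)
  with H have "e' \<subseteq> verts H" by (auto simp: simple_graph_def)
  with e e' f have "e = e'" by (metis inj_on_image_eq_iff)
  with e' show "e \<in> edges H" by simp
qed (auto simp: relabel_def)

lemma relabel_simple_graph:
  assumes f: "inj_on f (verts H)" and H: "simple_graph H"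
  shows "simple_graph (relabel f H)"
  using H unfolding simple_graph_def relabel_def
  by (auto simp: card_image inj_on_subset[OF f])

lemma relabel_independent:
  assumes f: "inj_on f (verts H)" and H: "simple_graph H" and S: "S \<subseteq> verts H"
  shows "independent (relabel f H) (f ` S) \<longleftrightarrow> independent H S"
proof -
  have "{f x, f y} \<in> edges (relabel f H) \<longleftrightarrow> {x, y} \<in> edges H" if "x \<in> S" "y \<in> S" for x y
    using relabel_edge_iff[OF f H, of "{x, y}"] that S by auto
  moreover have "f ` S \<subseteq> verts (relabel f H)" using S by (auto simp: relabel_def)
  ultimately show ?thesis using S unfolding independent_def by auto
qed

lemma relabel_edges_between:
  assumes f: "inj_on f (verts H)" and H: "simple_graph H"
    and S: "S \<subseteq> verts H" and U: "U \<subseteq> verts H"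
  shows "edges_between (relabel f H) (f ` S) (f ` U) = (`) f ` edges_between H S U"
proof -
  have iff: "{f s, f u} \<in> edges (relabel f H) \<longleftrightarrow> {s, u} \<in> edges H" if "s \<in> S" "u \<in> U" for s u
    using relabel_edge_iff[OF f H, of "{s, u}"] that S U by auto
  show ?thesis
  proof (intro equalityI subsetI)
    fix e assume "e \<in> edges_between (relabel f H) (f ` S) (f ` U)"
    then obtain s u where su: "s \<in> S" "u \<in> U" "e = f ` {s, u}" "{f s, f u} \<in> edges (relabel f H)"
      by (auto simp: edges_between_def)
    then have "{s, u} \<in> edges_between H S U" using iff by (auto simp: edges_between_def)
    with su show "e \<in> (`) f ` edges_between H S U" by blast
  next
    fix e assume "e \<in> (`) f ` edges_between H S U"
    then obtain s u where su: "s \<in> S" "u \<in> U" "e = {f s, f u}" "{s, u} \<in> edges H"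
      by (auto simp: edges_between_def)
    then show "e \<in> edges_between (relabel f H) (f ` S) (f ` U)"
      using iff by (auto simp: edges_between_def)
  qed
qed

lemma relabel_fold_cover:
  assumes c: "is_fold_cover q G L H" and f: "inj_on f (verts H)"
  shows "is_fold_cover q G (\<lambda>v. f ` L v) (relabel f H)"
proof -
  have H: "simple_graph H" and vH: "verts H = (\<Union>v\<in>verts G. L v)"
    using c by (auto simp: is_fold_cover_def is_cover_def)
  have sub: "L v \<subseteq> verts H" if "v \<in> verts G" for v using vH that by auto
  have esub: "edges_between H S U \<subseteq> Pow (verts H)" for S U
    using H by (auto simp: simple_graph_def edges_between_def)
  have "disjoint_family_on (\<lambda>v. f ` L v) (verts G)"
    unfolding disjoint_family_on_def
  proof (intro ballI impI)
    fix u v assume uv: "u \<in> verts G" "v \<in> verts G" "u \<noteq> v"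
    then have "L u \<inter> L v = {}"
      using c by (auto simp: is_fold_cover_def is_cover_def disjoint_family_on_def)
    then show "f ` L u \<inter> f ` L v = {}"
      using inj_on_image_Int[OF f sub sub, of u v] uv by simp
  qed
  moreover have "independent (relabel f H) (f ` L v)" if "v \<in> verts G" for v
    using relabel_independent[OF f H sub[OF that]] c that
    by (auto simp: is_fold_cover_def is_cover_def)
  moreover have "verts (relabel f H) = (\<Union>v\<in>verts G. f ` L v)"
    using vH by (auto simp: relabel_def)
  moreover have "disjoint (edges_between (relabel f H) (f ` L u) (f ` L v)) \<and>
      ({u, v} \<notin> edges G \<longrightarrow> edges_between (relabel f H) (f ` L u) (f ` L v) = {})"
    if uv: "u \<in> verts G" "v \<in> verts G" "u \<noteq> v" for u v
  proof -
    have d: "disjoint (edges_between H (L u) (L v))"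
      and e: "{u, v} \<notin> edges G \<longrightarrow> edges_between H (L u) (L v) = {}"
      using c uv by (auto simp: is_fold_cover_def is_cover_def)
    have "disjoint ((`) f ` edges_between H (L u) (L v))"
    proof (rule disjointI)
      fix a b assume "a \<in> (`) f ` edges_between H (L u) (L v)"
        "b \<in> (`) f ` edges_between H (L u) (L v)" and ab: "a \<noteq> b"
      then obtain a' b' where *: "a = f ` a'" "a' \<in> edges_between H (L u) (L v)"
        "b = f ` b'" "b' \<in> edges_between H (L u) (L v)" by blast
      with ab d have "a' \<inter> b' = {}" by (auto dest: disjointD)
      then show "a \<inter> b = {}"
        using * inj_on_image_Int[OF f, of a' b'] esub[of "L u" "L v"] by auto
    qed
    then show ?thesis
      using e by (simp add: relabel_edges_between[OF f H sub sub] uv)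
  qed
  moreover have "card (f ` L v) = q" if "v \<in> verts G" for v
    using card_image[OF inj_on_subset[OF f sub[OF that]]] c that
    by (auto simp: is_fold_cover_def)
  ultimately show ?thesis
    using relabel_simple_graph[OF f H] by (auto simp: is_fold_cover_def is_cover_def)
qed

lemma relabel_num_colorings:
  assumes c: "is_fold_cover q G L H" and f: "inj_on f (verts H)"
  shows "num_colorings G (\<lambda>v. f ` L v) (relabel f H) = num_colorings G L H"
proof -
  have H: "simple_graph H" and vH: "verts H = (\<Union>v\<in>verts G. L v)"
    using c by (auto simp: is_fold_cover_def is_cover_def)
  have iff: "proper_coloring G (\<lambda>v. f ` L v) (relabel f H) (f ` T) \<longleftrightarrow> proper_coloring G L H T"
    if T: "T \<subseteq> verts H" for T
  proof -
    have "card (f ` T \<inter> f ` L v) = card (T \<inter> L v)" if "v \<in> verts G" for v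
    proof -
      have "f ` T \<inter> f ` L v = f ` (T \<inter> L v)"
        using inj_on_image_Int[OF f T, of "L v"] that vH by auto
      then show ?thesis using T by (metis card_image inj_on_subset[OF f] le_infI1)
    qed
    moreover have "f ` T \<subseteq> verts (relabel f H)" using T by (auto simp: relabel_def)
    ultimately show ?thesis
      using T relabel_independent[OF f H T] by (auto simp: proper_coloring_def)
  qed
  have "{T. proper_coloring G (\<lambda>v. f ` L v) (relabel f H) T} =
      (`) f ` {T. proper_coloring G L H T}"
  proof (intro equalityI subsetI)
    fix T assume "T \<in> {T. proper_coloring G (\<lambda>v. f ` L v) (relabel f H) T}"
    then have pT: "proper_coloring G (\<lambda>v. f ` L v) (relabel f H) T" by simp
    then have "T \<subseteq> f ` verts H" by (simp add: proper_coloring_def relabel_def)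
    then obtain T' where "T' \<subseteq> verts H" "T = f ` T'" by (meson subset_imageE)
    with pT iff show "T \<in> (`) f ` {T. proper_coloring G L H T}" by blast
  next
    fix T assume "T \<in> (`) f ` {T. proper_coloring G L H T}"
    then obtain T' where T': "T = f ` T'" "proper_coloring G L H T'" by blast
    then show "T \<in> {T. proper_coloring G (\<lambda>v. f ` L v) (relabel f H) T}"
      using iff[of T'] by (simp add: proper_coloring_def)
  qed
  moreover have "inj_on ((`) f) {T. proper_coloring G L H T}"
    by (rule inj_onI) (use f in \<open>auto simp: proper_coloring_def inj_on_image_eq_iff\<close>)
  ultimately show ?thesis by (simp add: num_colorings_def card_image)
qed

lemma DP_color_function_le:
  fixes L :: "'a \<Rightarrow> 'b set"
  assumes "is_fold_cover q G L H"
  shows "DP_color_function G q \<le> num_colorings G L H"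
proof -
  have "finite (verts H)"
    using assms unfolding is_fold_cover_def is_cover_def simple_graph_def by blast
  then obtain f :: "'b \<Rightarrow> nat" where f: "inj_on f (verts H)"
    using finite_imp_inj_to_nat_seg by blast
  show ?thesis
    unfolding DP_color_function_def
    by (rule Least_le) (use relabel_fold_cover[OF assms f] relabel_num_colorings[OF assms f] in metis)
qed

lemma fold_cover_exists:
  assumes G: "simple_graph G" and q: "1 \<le> q"
  shows "\<exists>(L :: 'a \<Rightarrow> ('a \<times> nat) set) H. is_fold_cover q (G :: 'a ugraph) L H"
proof (intro exI)
  let ?L = "\<lambda>v. {v} \<times> {..<q}"
  show "is_fold_cover q G ?L \<lparr>verts = (\<Union>v\<in>verts G. ?L v), edges = {}\<rparr>"
    using G q by (auto simp: is_fold_cover_def is_cover_def simple_graph_def independent_def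
        edges_between_def disjoint_family_on_def lessThan_empty_iff disjoint_def)
qed

lemma DP_color_function_attained:
  assumes G: "simple_graph G" and q: "1 \<le> q"
  shows "\<exists>(L :: 'a \<Rightarrow> nat set) H.
    is_fold_cover q (G :: 'a ugraph) L H \<and> DP_color_function G q = num_colorings G L H"
proof -
  obtain L :: "'a \<Rightarrow> ('a \<times> nat) set" and H where c: "is_fold_cover q G L H"
    using fold_cover_exists[OF G q] by blast
  then have "finite (verts H)"
    unfolding is_fold_cover_def is_cover_def simple_graph_def by blast
  then obtain f :: "'a \<times> nat \<Rightarrow> nat" where f: "inj_on f (verts H)"
    using finite_imp_inj_to_nat_seg by blast
  show ?thesis
    unfolding DP_color_function_def
    by (rule LeastI_ex) (use relabel_fold_cover[OF c f] in blast)
qed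

end

theory Submission
  imports Defs "HOL-Library.FuncSet" "HOL-Library.Nat_Bijection" "HOL-Number_Theory.Cong"
begin

text \<open>Choosing one vertex of each \<open>L v\<close> gives a transversal \<open>s\<close>. An edge \<open>e\<close> of \<open>G\<close> is
  hit by \<open>s\<close> if the two vertices chosen over its ends are adjacent in the cover graph; the
  proper colorings are the transversals that hit no edge. Writing \<open>N(A)\<close> for the number of
  transversals that hit every edge of \<open>A\<close>, inclusion-exclusion counts the proper colorings as
  \<open>\<Sum>A\<subseteq>E. (-1)^|A| N(A)\<close> (\<open>card_avoiders\<close>).

  If all matchings of the cover are perfect, then a forest \<open>A\<close> has \<open>N(A) = q^(n - |A|)\<close>: at a
  leaf, the choice there is dictated by the choice at its neighbour
  (\<open>card_hits_pendant\<close>, \<open>card_hits_forest\<close>). Since a forest with \<open>j\<close> edges has \<open>n - j\<close>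
  components, the forests together contribute exactly the claimed polynomial, called the
  forest sum below. It remains to see that the edge sets containing a cycle contribute
  nothing for one cover and a nonnegative amount for every cover.

  For the first, orient all edges from one part of the bipartition to the other, number them
  \<open>0, \<dots>, m - 1\<close>, take every \<open>L v\<close> to be a copy of the integers modulo \<open>q\<close>, and match
  along the \<open>i\<close>-th edge by adding \<open>2^i\<close>. A transversal hitting all edges of a cycle makes the
  alternating sum of their powers of two vanish modulo \<open>q\<close>. As \<open>q \<ge> 2^m\<close>, uniqueness of
  binary expansions forbids this, so \<open>N(A) = 0\<close> as soon as \<open>A\<close> contains a cycle
  (\<open>num_colorings_eq_forest_sum\<close>).

  For the second, completing the matchings to perfect ones only destroys colorings, so assume
  them perfect. Assign to each \<open>A\<close> that is not a forest the edge set \<open>C\<close> of a shortest cycle of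
  \<open>A\<close>. It has even size because \<open>G\<close> is bipartite, so the set \<open>C\<close> itself counts with sign
  \<open>+1\<close>. Every other \<open>A\<close> assigned to \<open>C\<close> has an edge with an end off the cycle, for a chord would
  give a shorter cycle; that edge costs a factor \<open>q\<close>, so \<open>q N(A) \<le> N(C)\<close>. There are at
  most \<open>2^m \<le> q\<close> such \<open>A\<close>, hence each group has a nonnegative sum
  (\<open>forest_sum_le_avoiders\<close>).\<close>

section \<open>Cycles, forests and leaves\<close>

definition cycle_edges :: "'a list \<Rightarrow> 'a set set" where
  "cycle_edges vs = (\<lambda>i. {vs ! i, vs ! (Suc i mod length vs)}) ` {..<length vs}"

definition forest :: "'a set set \<Rightarrow> bool" where
  "forest A \<longleftrightarrow> (\<forall>vs. 3 \<le> length vs \<longrightarrow> distinct vs \<longrightarrow> \<not> cycle_edges vs \<subseteq> A)"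

lemma acyclic_graph_iff_forest: "acyclic_graph S \<longleftrightarrow> forest (edges S)"
  by (auto simp: acyclic_graph_def cycle_def forest_def cycle_edges_def image_subset_iff)

lemma Suc_mod_eq_if: "i < k \<Longrightarrow> Suc i mod k = (if Suc i = k then 0 else Suc i)"
  by (simp add: mod_Suc)

lemma inj_on_cycle_edges:
  assumes "3 \<le> length vs" "distinct vs"
  shows "inj_on (\<lambda>i. {vs ! i, vs ! (Suc i mod length vs)}) {..<length vs}"
proof (rule inj_onI)
  fix i j assume ij: "i \<in> {..<length vs}" "j \<in> {..<length vs}"
    and eq: "{vs ! i, vs ! (Suc i mod length vs)} = {vs ! j, vs ! (Suc j mod length vs)}"
  let ?k = "length vs"
  have k: "0 < ?k" using assms by linarith
  have lt: "i < ?k" "j < ?k" "Suc i mod ?k < ?k" "Suc j mod ?k < ?k"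
    using ij k by auto
  from eq have "i = j \<or> (i = Suc j mod ?k \<and> Suc i mod ?k = j)"
    using lt assms(2) by (auto simp: doubleton_eq_iff nth_eq_iff_index_eq)
  then show "i = j"
    using lt assms(1) by (auto simp: Suc_mod_eq_if split: if_splits)
qed

lemma card_cycle_edges:
  assumes "3 \<le> length vs" "distinct vs"
  shows "card (cycle_edges vs) = length vs"
  unfolding cycle_edges_def using card_image[OF inj_on_cycle_edges[OF assms]] by simp

lemma forest_subset: "forest A \<Longrightarrow> B \<subseteq> A \<Longrightarrow> forest B"
  unfolding forest_def by blast

text \<open>The first vertex of a longest path is a leaf: a second neighbour of it would either
  prolong the path or, lying on the path, close a cycle.\<close>

lemma forest_leaf:
  assumes A: "forest A" "finite A" "A \<noteq> {}" and two: "\<And>e. e \<in> A \<Longrightarrow> card e = 2"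
  obtains u v where "{u, v} \<in> A" "u \<noteq> v" "v \<notin> \<Union>(A - {{u, v}})"
proof -
  define P where "P p \<longleftrightarrow> 2 \<le> length p \<and> distinct p \<and>
    (\<forall>i. Suc i < length p \<longrightarrow> {p ! i, p ! Suc i} \<in> A)" for p
  obtain e where "e \<in> A" using A by auto
  then obtain a b where ab: "{a, b} \<in> A" "a \<noteq> b" using two by (metis card_2_iff)
  have start: "P [a, b]" using ab by (auto simp: P_def)
  have fin: "finite (\<Union>A)" using A two by (metis finite_Union card.infinite zero_neq_numeral)
  have bound: "\<forall>p. P p \<longrightarrow> length p < Suc (card (\<Union>A))"
  proof (intro allI impI)
    fix p assume p: "P p"
    have "set p \<subseteq> \<Union>A"
    proof
      fix x assume "x \<in> set p"
      then obtain i where i: "i < length p" "x = p ! i" by (metis in_set_conv_nth)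
      show "x \<in> \<Union>A"
      proof (cases "Suc i < length p")
        case True
        then have "{p ! i, p ! Suc i} \<in> A" using p by (simp add: P_def)
        then show ?thesis using i by auto
      next
        case False
        then obtain i' where "i = Suc i'" using p i by (cases i) (auto simp: P_def)
        then have "{p ! i', p ! i} \<in> A" using p i by (simp add: P_def)
        then show ?thesis using i by auto
      qed
    qed
    then have "card (set p) \<le> card (\<Union>A)" using fin by (rule card_mono[rotated])
    moreover have "card (set p) = length p" using p by (simp add: P_def distinct_card)
    ultimately show "length p < Suc (card (\<Union>A))" by simp
  qed
  obtain p where p: "P p" and max: "\<And>p'. P p' \<Longrightarrow> length p' \<le> length p"
    using ex_has_greatest_nat[of P, OF start bound] by blast
  then have "2 \<le> length p" by (simp add: P_def)
  then obtain v u r where pr: "p = v # u # r" by (cases p; cases "tl p") auto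
  have vu: "{v, u} \<in> A" "v \<noteq> u" using p unfolding P_def pr by auto
  have "v \<notin> \<Union>(A - {{u, v}})"
  proof
    assume "v \<in> \<Union>(A - {{u, v}})"
    then obtain e where e: "e \<in> A" "v \<in> e" "e \<noteq> {u, v}" by auto
    then obtain w where w: "e = {v, w}" "w \<noteq> v" "w \<noteq> u"
      using two[OF e(1)] by (metis card_2_iff doubleton_eq_iff insertE singletonD)
    show False
    proof (cases "w \<in> set p")
      case False
      have "P (w # p)" unfolding P_def
      proof (intro conjI allI impI)
        show "2 \<le> length (w # p)" "distinct (w # p)" using p False by (auto simp: P_def)
        fix i assume "Suc i < length (w # p)"
        then show "{(w # p) ! i, (w # p) ! Suc i} \<in> A"
          using p w e by (cases i) (auto simp: P_def pr insert_commute)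
      qed
      then show False using max by fastforce
    next
      case True
      then obtain j where j: "j < length p" "w = p ! j" by (metis in_set_conv_nth)
      have j2: "2 \<le> j"
      proof (rule ccontr)
        assume "\<not> 2 \<le> j"
        then have "j = 0 \<or> j = 1" by auto
        then show False using j w by (auto simp: pr)
      qed
      let ?c = "take (Suc j) p"
      have len: "length ?c = Suc j" using j by simp
      have "cycle_edges ?c \<subseteq> A"
        unfolding cycle_edges_def len
      proof (intro image_subsetI)
        fix i assume i: "i \<in> {..<Suc j}"
        show "{?c ! i, ?c ! (Suc i mod Suc j)} \<in> A"
        proof (cases "i = j")
          case True
          have "?c ! j = w" using j by simp
          moreover have "?c ! 0 = v" by (simp add: pr)
          ultimately show ?thesis using True w e by (simp add: insert_commute)
        next
          case False
          then have "Suc i < Suc j" using i by simp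
          then show ?thesis using p j by (simp add: P_def)
        qed
      qed
      moreover have "3 \<le> length ?c" "distinct ?c" using j2 len p by (auto simp: P_def)
      ultimately show False using A(1) unfolding forest_def by blast
    qed
  qed
  then show thesis using that[of u v] vu by (simp add: insert_commute)
qed

section \<open>Shortest cycles\<close>

definition shortest_cycle :: "'a set set \<Rightarrow> 'a list \<Rightarrow> bool" where
  "shortest_cycle A vs \<longleftrightarrow> 3 \<le> length vs \<and> distinct vs \<and> cycle_edges vs \<subseteq> A \<and>
     (\<forall>ws. 3 \<le> length ws \<longrightarrow> distinct ws \<longrightarrow> cycle_edges ws \<subseteq> A \<longrightarrow> length vs \<le> length ws)"

text \<open>A fixed choice of a shortest cycle; the edge sets that are not forests are grouped by
  this choice in the lower bound.\<close>

definition min_cycle :: "'a set set \<Rightarrow> 'a set set" where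
  "min_cycle A = cycle_edges (SOME vs. shortest_cycle A vs)"

lemma min_cycleE:
  assumes "\<not> forest A"
  obtains vs where "shortest_cycle A vs" "min_cycle A = cycle_edges vs"
proof -
  let ?P = "\<lambda>vs. 3 \<le> length vs \<and> distinct vs \<and> cycle_edges vs \<subseteq> A"
  obtain vs0 where "?P vs0" using assms unfolding forest_def by blast
  then have "\<exists>vs. ?P vs \<and> (\<forall>ws. ?P ws \<longrightarrow> length vs \<le> length ws)"
    using ex_has_least_nat[of ?P vs0 length] by blast
  then have "\<exists>vs. shortest_cycle A vs" unfolding shortest_cycle_def by blast
  then have "shortest_cycle A (SOME vs. shortest_cycle A vs)" by (rule someI_ex)
  then show thesis using that unfolding min_cycle_def by blast
qed

lemma min_cycle_subset: "\<not> forest A \<Longrightarrow> min_cycle A \<subseteq> A"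
  by (metis min_cycleE shortest_cycle_def)

lemma min_cycle_not_forest: "\<not> forest A \<Longrightarrow> \<not> forest (min_cycle A)"
  by (metis min_cycleE shortest_cycle_def forest_def order_refl)

text \<open>A cycle inside a shortest cycle cannot be shorter, so it uses all of its edges. Hence each
  chosen cycle is a member of its own group.\<close>

lemma min_cycle_idem:
  assumes A: "\<not> forest A"
  shows "min_cycle (min_cycle A) = min_cycle A"
proof -
  obtain vs where vs: "shortest_cycle A vs" "min_cycle A = cycle_edges vs"
    using min_cycleE[OF A] .
  obtain ws where ws: "shortest_cycle (min_cycle A) ws" "min_cycle (min_cycle A) = cycle_edges ws"
    using min_cycleE[OF min_cycle_not_forest[OF A]] .
  have sub: "cycle_edges ws \<subseteq> cycle_edges vs" using ws vs by (simp add: shortest_cycle_def)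
  then have "length vs \<le> length ws" using vs ws unfolding shortest_cycle_def by (meson order_trans)
  then have "card (cycle_edges vs) \<le> card (cycle_edges ws)"
    using vs ws by (simp add: shortest_cycle_def card_cycle_edges)
  moreover have "finite (cycle_edges vs)" by (simp add: cycle_edges_def)
  ultimately have "cycle_edges ws = cycle_edges vs" using sub by (metis card_seteq)
  then show ?thesis using vs ws by simp
qed

lemma Union_cycle_edges:
  shows "\<Union>(cycle_edges vs) = set vs"
proof -
  have "Suc i mod length vs < length vs" if "i < length vs" for i
    using that by (cases vs) auto
  then show ?thesis unfolding cycle_edges_def by (fastforce simp: in_set_conv_nth)
qed

text \<open>A chord joins positions \<open>i < j\<close> of the cycle; the segment from \<open>i\<close> to \<open>j\<close> together
  with the chord is a shorter cycle.\<close>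

lemma shortest_cycle_chordless:
  assumes vs: "shortest_cycle A vs" and e: "e \<in> A" "card e = 2" "e \<subseteq> set vs"
  shows "e \<in> cycle_edges vs"
proof (rule ccontr)
  assume ne: "e \<notin> cycle_edges vs"
  obtain x y where xy: "e = {x, y}" "x \<noteq> y" using e by (metis card_2_iff)
  have "\<exists>i j. i < j \<and> j < length vs \<and> e = {vs ! i, vs ! j}"
  proof -
    obtain i j where "i < length vs" "j < length vs" "x = vs ! i" "y = vs ! j"
      using e xy by (metis in_set_conv_nth insert_subset)
    then show ?thesis using xy by (cases i j rule: linorder_cases) auto
  qed
  then obtain i j where ij: "i < j" "j < length vs" "e = {vs ! i, vs ! j}" by blast
  let ?k = "length vs"
  have dist: "distinct vs" and sub: "cycle_edges vs \<subseteq> A" using vs by (auto simp: shortest_cycle_def)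
  have edge: "{vs ! t, vs ! (Suc t mod ?k)} \<in> cycle_edges vs" if "t < ?k" for t
    using that by (auto simp: cycle_edges_def)
  have "j \<noteq> Suc i" using edge[of i] ij ne by auto
  moreover have "\<not> (i = 0 \<and> Suc j = ?k)" using edge[of j] ij ne by (auto simp: insert_commute)
  ultimately have gap: "i + 2 \<le> j" "Suc j - i < ?k" using ij by auto
  let ?c = "take (Suc j - i) (drop i vs)"
  have len: "length ?c = Suc j - i" using ij by simp
  have nth: "?c ! t = vs ! (i + t)" if "t < Suc j - i" for t using that ij by simp
  have "cycle_edges ?c \<subseteq> A"
    unfolding cycle_edges_def len
  proof (intro image_subsetI)
    fix t assume t: "t \<in> {..<Suc j - i}"
    show "{?c ! t, ?c ! (Suc t mod (Suc j - i))} \<in> A"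
    proof (cases "Suc t = Suc j - i")
      case True
      then have "i + t = j" using ij by simp
      then show ?thesis using True e ij nth[of t] nth[of 0] t by (simp add: insert_commute)
    next
      case False
      then have "Suc t < Suc j - i" using t by simp
      moreover have "{vs ! (i + t), vs ! Suc (i + t)} \<in> A"
        using edge[of "i + t"] sub calculation ij by auto
      ultimately show ?thesis using nth[of t] nth[of "Suc t"] by simp
    qed
  qed
  moreover have "3 \<le> length ?c" "distinct ?c" using gap len dist by auto
  ultimately have "?k \<le> length ?c" using vs unfolding shortest_cycle_def by blast
  then show False using gap len by simp
qed

lemma min_cycle_leaving_edge:
  assumes A: "\<not> forest A" and ne: "A \<noteq> min_cycle A" and two: "\<And>e. e \<in> A \<Longrightarrow> card e = 2"
  obtains u v where "{u, v} \<in> A" "u \<noteq> v" "v \<notin> \<Union>(min_cycle A)"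
proof -
  obtain vs where vs: "shortest_cycle A vs" "min_cycle A = cycle_edges vs"
    using min_cycleE[OF A] .
  obtain e where e: "e \<in> A" "e \<notin> min_cycle A" using ne min_cycle_subset[OF A] by blast
  then have "\<not> e \<subseteq> \<Union>(min_cycle A)"
    using shortest_cycle_chordless[OF vs(1) e(1)] two vs(2) by (auto simp: Union_cycle_edges)
  then obtain v where "v \<in> e" "v \<notin> \<Union>(min_cycle A)" by blast
  moreover obtain a b where "e = {a, b}" "a \<noteq> b" using two[OF e(1)] by (metis card_2_iff)
  ultimately show thesis using that e(1) by (metis insertE insert_commute singletonD)
qed

text \<open>Membership in \<open>X\<close> alternates along the cycle and has to flip once more on the closing
  edge.\<close>

lemma even_cycle:
  assumes X: "\<And>u v. {u, v} \<in> E \<Longrightarrow> u \<in> X \<longleftrightarrow> v \<notin> X"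
    and vs: "3 \<le> length vs" "cycle_edges vs \<subseteq> E"
  shows "even (length vs)"
proof -
  let ?k = "length vs"
  have edge: "{vs ! t, vs ! (Suc t mod ?k)} \<in> E" if "t < ?k" for t
    using that vs by (auto simp: cycle_edges_def)
  have alt: "vs ! i \<in> X \<longleftrightarrow> (even i \<longleftrightarrow> vs ! 0 \<in> X)" if "i < ?k" for i
    using that
  proof (induction i)
    case (Suc i)
    then show ?case using X[OF edge[of i]] by auto
  qed simp
  have "vs ! (?k - 1) \<in> X \<longleftrightarrow> vs ! 0 \<notin> X"
  proof -
    have "Suc (?k - 1) = ?k" using vs(1) by linarith
    then show ?thesis using X[OF edge[of "?k - 1"]] by simp
  qed
  moreover have "?k - 1 < ?k" "even (?k - 1) \<longleftrightarrow> odd ?k" using vs(1) by auto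
  ultimately show ?thesis using alt[of "?k - 1"] by auto
qed

section \<open>Counting transversals of perfect matchings\<close>

text \<open>The data of a cover with perfect matchings, reduced to what counting needs: \<open>M e\<close> holds
  the cover edges over \<open>e\<close>. The sets \<open>L v\<close> may overlap, which lets the constant choices
  of the component count below be an instance.\<close>

locale matching_system =
  fixes V :: "'a set" and E :: "'a set set" and q :: nat
    and L :: "'a \<Rightarrow> 'b set" and M :: "'a set \<Rightarrow> 'b set set"
  assumes finite_V: "finite V" and q_pos: "0 < q"
    and edge: "\<And>e. e \<in> E \<Longrightarrow> e \<subseteq> V \<and> card e = 2"
    and card_L: "\<And>v. v \<in> V \<Longrightarrow> card (L v) = q"
    and perfect: "\<And>u v x. {u, v} \<in> E \<Longrightarrow> u \<noteq> v \<Longrightarrow> x \<in> L u \<Longrightarrow> \<exists>!y. y \<in> L v \<and> {x, y} \<in> M {u, v}"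
begin

definition hits :: "'a set set \<Rightarrow> ('a \<Rightarrow> 'b) set" where
  "hits A = {s \<in> PiE V L. \<forall>e\<in>A. s ` e \<in> M e}"

definition avoiders :: "('a \<Rightarrow> 'b) set" where
  "avoiders = {s \<in> PiE V L. \<forall>e\<in>E. s ` e \<notin> M e}"

lemma finite_L: "v \<in> V \<Longrightarrow> finite (L v)"
  using card_L q_pos by (metis card.infinite less_irrefl)

lemma finite_PiE_L: "finite (PiE V L)"
  using finite_V finite_L by (rule finite_PiE)

lemma finite_hits: "finite (hits A)"
  using finite_PiE_L by (auto simp: hits_def)

lemma finite_E: "finite E"
  using edge finite_V by (auto intro: finite_subset[of E "Pow V"])

text \<open>The edge \<open>{u, v}\<close> dictates the value at \<open>v\<close> from the value at \<open>u\<close>, while the edges of \<open>C\<close>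
  leave the value at \<open>v\<close> free. This is where the matchings being perfect
  enters the count.\<close>

lemma card_hits_pendant:
  assumes C: "C \<subseteq> E" and uv: "{u, v} \<in> E" "u \<noteq> v" and v: "v \<notin> \<Union>C"
  shows "q * card (hits (insert {u, v} C)) = card (hits C)"
proof -
  have inV: "u \<in> V" "v \<in> V" using edge[OF uv(1)] by auto
  define y where "y x = (THE y. y \<in> L v \<and> {x, y} \<in> M {u, v})" for x
  have y: "y x \<in> L v" "{x, y x} \<in> M {u, v}" if "x \<in> L u" for x
    using theI'[OF perfect[OF uv that]] by (auto simp: y_def)
  have y_eq: "z = y x" if "x \<in> L u" "z \<in> L v" "{x, z} \<in> M {u, v}" for x z
    using perfect[OF uv that(1)] y[OF that(1)] that by blast
  have upd: "s(v := z) \<in> PiE V L" if "s \<in> PiE V L" "z \<in> L v" for s z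
    using that inV by (auto simp: PiE_iff extensional_def)
  have img: "s(v := z) ` e = s ` e" if "e \<in> C" for s z and e :: "'a set"
    using that v by (intro image_cong) auto
  have su: "s u \<in> L u" "s v \<in> L v" if "s \<in> PiE V L" for s using that inV by auto
  have "bij_betw (\<lambda>(s, z). s(v := z)) (hits (insert {u, v} C) \<times> L v) (hits C)"
  proof (rule bij_betw_byWitness[where f' = "\<lambda>s. (s(v := y (s u)), s v)"])
    show "\<forall>p\<in>hits (insert {u, v} C) \<times> L v.
        (\<lambda>s. (s(v := y (s u)), s v)) (case p of (s, z) \<Rightarrow> s(v := z)) = p"
    proof
      fix p assume "p \<in> hits (insert {u, v} C) \<times> L v"
      then obtain s z where p: "p = (s, z)" and s: "s \<in> hits (insert {u, v} C)" by blast
      then have "s v = y (s u)" using y_eq[of "s u" "s v"] su by (auto simp: hits_def)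
      then have "s(v := y (s u)) = s" by (metis fun_upd_triv)
      then show "(\<lambda>s. (s(v := y (s u)), s v)) (case p of (s, z) \<Rightarrow> s(v := z)) = p"
        using p uv by simp
    qed
    show "\<forall>s\<in>hits C. (case (s(v := y (s u)), s v) of (s, z) \<Rightarrow> s(v := z)) = s"
      by simp
    show "(\<lambda>(s, z). s(v := z)) ` (hits (insert {u, v} C) \<times> L v) \<subseteq> hits C"
    proof (intro image_subsetI)
      fix p assume "p \<in> hits (insert {u, v} C) \<times> L v"
      then obtain s z where p: "p = (s, z)" and s: "s \<in> hits (insert {u, v} C)" and z: "z \<in> L v"
        by blast
      have "s(v := z) \<in> PiE V L" using upd s z by (simp add: hits_def)
      moreover have "s(v := z) ` e \<in> M e" if "e \<in> C" for e
        unfolding img[OF that] using s that by (simp add: hits_def)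
      ultimately show "(case p of (s, z) \<Rightarrow> s(v := z)) \<in> hits C" using p by (simp add: hits_def)
    qed
    show "(\<lambda>s. (s(v := y (s u)), s v)) ` hits C \<subseteq> hits (insert {u, v} C) \<times> L v"
    proof (intro image_subsetI)
      fix s assume "s \<in> hits C"
      then have s: "s \<in> PiE V L" "\<And>e. e \<in> C \<Longrightarrow> s ` e \<in> M e" by (auto simp: hits_def)
      let ?s = "s(v := y (s u))"
      have "?s ` {u, v} = {s u, y (s u)}" using uv by auto
      then have "?s ` {u, v} \<in> M {u, v}" using y su[OF s(1)] by simp
      moreover have "?s ` e \<in> M e" if "e \<in> C" for e
        unfolding img[OF that] using s(2)[OF that] .
      moreover have "?s \<in> PiE V L" using upd s(1) y su by blast
      ultimately have "?s \<in> hits (insert {u, v} C)" unfolding hits_def by blast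
      then show "(?s, s v) \<in> hits (insert {u, v} C) \<times> L v" using su(2)[OF s(1)] by blast
    qed
  qed
  then have "card (hits (insert {u, v} C) \<times> L v) = card (hits C)" by (rule bij_betw_same_card)
  then show ?thesis using card_L[OF inV(2)] by (simp add: card_cartesian_product mult.commute)
qed

lemma card_hits_forest:
  assumes "A \<subseteq> E" "forest A"
  shows "card (hits A) * q ^ card A = q ^ card V"
  using assms
proof (induction "card A" arbitrary: A)
  case 0
  moreover have "finite A" using finite_subset[OF 0(2) finite_E] .
  ultimately have "A = {}" by simp
  then have "hits A = PiE V L" by (auto simp: hits_def)
  then show ?case using finite_V \<open>A = {}\<close> by (simp add: card_PiE card_L)
next
  case (Suc k)
  have fin: "finite A" and ne: "A \<noteq> {}" using Suc.hyps(2) card_gt_0_iff[of A] by auto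
  have "card e = 2" if "e \<in> A" for e using that Suc.prems edge by blast
  then obtain u v where uv: "{u, v} \<in> A" "u \<noteq> v" "v \<notin> \<Union>(A - {{u, v}})"
    using forest_leaf[OF Suc.prems(2) fin ne] by blast
  let ?B = "A - {{u, v}}"
  have IH: "card (hits ?B) * q ^ card ?B = q ^ card V"
  proof (rule Suc.hyps(1))
    show "k = card ?B" using Suc.hyps(2) uv(1) fin by simp
    show "?B \<subseteq> E" using Suc.prems(1) by auto
    show "forest ?B" using Suc.prems(2) by (rule forest_subset) auto
  qed
  have "insert {u, v} ?B = A" "?B \<subseteq> E" "{u, v} \<in> E" using uv Suc.prems by auto
  then have pendant: "card (hits ?B) = q * card (hits A)"
    using card_hits_pendant[of ?B u v] uv by simp
  have "card A = Suc (card ?B)" using uv fin by (metis card_Suc_Diff1)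
  then have "card (hits A) * q ^ card A = q * card (hits A) * q ^ card ?B" by simp
  also have "\<dots> = q ^ card V" using IH pendant by simp
  finally show ?case .
qed

text \<open>Inclusion-exclusion: for each transversal, expand the product over \<open>E\<close> of
  \<open>1 - [e is hit]\<close>.\<close>

lemma card_avoiders:
  "int (card avoiders) = (\<Sum>A\<in>Pow E. (- 1) ^ card A * int (card (hits A)))"
proof -
  have fE: "finite E" by (rule finite_E)
  have ind: "of_bool (\<forall>e\<in>E. s ` e \<notin> M e) =
      (\<Sum>A\<in>Pow E. (- 1) ^ card A * of_bool (\<forall>e\<in>A. s ` e \<in> M e) :: int)" for s :: "'a \<Rightarrow> 'b"
  proof -
    let ?g = "\<lambda>e. - of_bool (s ` e \<in> M e) :: int"
    have "of_bool (\<forall>e\<in>E. s ` e \<notin> M e) = (\<Prod>e\<in>E. ?g e + 1)"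
    proof (cases "\<forall>e\<in>E. s ` e \<notin> M e")
      case False
      then obtain e where "e \<in> E" "?g e + 1 = 0" by auto
      then have "(\<Prod>e\<in>E. ?g e + 1) = 0" using fE by (meson prod_zero)
      then show ?thesis using False by simp
    qed auto
    also have "\<dots> = (\<Sum>A\<in>Pow E. prod ?g A)" using prod_add[OF fE, of ?g "\<lambda>_. 1"] by simp
    also have "\<dots> = (\<Sum>A\<in>Pow E. (- 1) ^ card A * of_bool (\<forall>e\<in>A. s ` e \<in> M e))"
    proof (intro sum.cong refl)
      fix A assume "A \<in> Pow E"
      then have fA: "finite A" using fE finite_subset by auto
      show "prod ?g A = (- 1) ^ card A * of_bool (\<forall>e\<in>A. s ` e \<in> M e)"
        using fA by (induction A) auto
    qed
    finally show ?thesis .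
  qed
  have "int (card avoiders) = (\<Sum>s\<in>PiE V L. of_bool (\<forall>e\<in>E. s ` e \<notin> M e))"
    using finite_PiE_L by (simp add: avoiders_def of_bool_def sum.If_cases Collect_conj_eq)
  also have "\<dots> = (\<Sum>A\<in>Pow E. \<Sum>s\<in>PiE V L. (- 1) ^ card A * of_bool (\<forall>e\<in>A. s ` e \<in> M e))"
    unfolding ind by (rule sum.swap)
  also have "\<dots> = (\<Sum>A\<in>Pow E. (- 1) ^ card A * int (card (hits A)))"
    using finite_PiE_L
    by (simp add: hits_def of_bool_def sum.If_cases Collect_conj_eq flip: sum_distrib_left)
  finally show ?thesis .
qed

definition forest_sum :: int where
  "forest_sum = (\<Sum>A | A \<subseteq> E \<and> forest A. (- 1) ^ card A * int q ^ (card V - card A))"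

text \<open>If a forest had more edges than there are vertices, \<open>card_hits_forest\<close> would only allow the
  value 1, which is what truncated subtraction gives; so the two cases agree.\<close>

lemma card_avoiders_split:
  "int (card avoiders) = forest_sum +
     (\<Sum>A | A \<subseteq> E \<and> \<not> forest A. (- 1) ^ card A * int (card (hits A)))"
proof -
  have "card (hits A) = q ^ (card V - card A)" if "A \<subseteq> E" "forest A" for A
  proof -
    have eq: "card (hits A) * q ^ card A = q ^ card V" using card_hits_forest[OF that] .
    have q0: "0 < q ^ k" for k using q_pos by simp
    show ?thesis
    proof (cases "card A \<le> card V")
      case True
      have "q ^ card V = q ^ (card V - card A) * q ^ card A"
        unfolding power_add[symmetric] using True by simp
      then show ?thesis using eq q0[of "card A"] by (metis mult_right_cancel less_irrefl)
    next
      case False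
      have "q ^ card A = q ^ (card A - card V) * q ^ card V"
        unfolding power_add[symmetric] using False by simp
      then have "(card (hits A) * q ^ (card A - card V)) * q ^ card V = 1 * q ^ card V"
        using eq by (metis mult.assoc mult_1)
      then have "card (hits A) * q ^ (card A - card V) = 1"
        using q0[of "card V"] by (metis mult_right_cancel less_irrefl)
      then show ?thesis using False by simp
    qed
  qed
  then have forests: "forest_sum = (\<Sum>A | A \<subseteq> E \<and> forest A. (- 1) ^ card A * int (card (hits A)))"
    unfolding forest_sum_def by (intro sum.cong) auto
  have Pow: "Pow E = {A. A \<subseteq> E \<and> forest A} \<union> {A. A \<subseteq> E \<and> \<not> forest A}" by auto
  have "(\<Sum>A\<in>{A. A \<subseteq> E \<and> forest A} \<union> {A. A \<subseteq> E \<and> \<not> forest A}. g A) =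
      (\<Sum>A | A \<subseteq> E \<and> forest A. g A) + (\<Sum>A | A \<subseteq> E \<and> \<not> forest A. g A)" for g :: "'a set set \<Rightarrow> int"
    using finite_E by (intro sum.union_disjoint) auto
  then show ?thesis unfolding card_avoiders Pow forests .
qed

text \<open>An edge of \<open>A\<close> leaving the vertex set of its chosen cycle is pendant over that cycle, and
  hitting further edges only lowers the count.\<close>

lemma card_hits_not_forest:
  assumes A: "A \<subseteq> E" "\<not> forest A" "A \<noteq> min_cycle A"
  shows "q * card (hits A) \<le> card (hits (min_cycle A))"
proof -
  have "card e = 2" if "e \<in> A" for e using that A edge by blast
  then obtain u v where uv: "{u, v} \<in> A" "u \<noteq> v" "v \<notin> \<Union>(min_cycle A)"
    using min_cycle_leaving_edge[OF A(2,3)] by blast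
  have sub: "min_cycle A \<subseteq> A" using min_cycle_subset[OF A(2)] .
  then have "hits A \<subseteq> hits (insert {u, v} (min_cycle A))" using uv by (auto simp: hits_def)
  then have "card (hits A) \<le> card (hits (insert {u, v} (min_cycle A)))"
    using finite_hits by (intro card_mono)
  moreover have "q * card (hits (insert {u, v} (min_cycle A))) = card (hits (min_cycle A))"
    using sub A uv by (intro card_hits_pendant) auto
  ultimately show ?thesis by (metis mult_le_mono2)
qed

text \<open>Within the group of a cycle \<open>C\<close>, the term of \<open>C\<close> is positive since \<open>C\<close> is even, and it
  outweighs the at most \<open>2^|E|\<close> other terms, each at most its \<open>q\<close>-th part.\<close>

lemma forest_sum_le_avoiders:
  assumes X: "\<And>u v. {u, v} \<in> E \<Longrightarrow> u \<in> X \<longleftrightarrow> v \<notin> X" and q: "2 ^ card E \<le> q"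
  shows "forest_sum \<le> int (card avoiders)"
proof -
  let ?S = "{A. A \<subseteq> E \<and> \<not> forest A}"
  let ?g = "\<lambda>A. (- 1) ^ card A * int (card (hits A))"
  have fS: "finite ?S" using finite_E by simp
  have "0 \<le> (\<Sum>A\<in>{A \<in> ?S. min_cycle A = C}. ?g A)" if "C \<in> min_cycle ` ?S" for C
  proof -
    obtain B where B: "B \<subseteq> E" "\<not> forest B" "C = min_cycle B" using \<open>C \<in> min_cycle ` ?S\<close> by auto
    have C: "C \<subseteq> E" "\<not> forest C" "min_cycle C = C"
      using B min_cycle_subset[OF B(2)] min_cycle_not_forest[OF B(2)] min_cycle_idem[OF B(2)] by auto
    obtain vs where vs: "shortest_cycle B vs" "C = cycle_edges vs"
      using min_cycleE[OF B(2)] B(3) by metis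
    then have even: "even (card C)"
      using even_cycle[where vs = vs, OF X] C(1) by (simp add: shortest_cycle_def card_cycle_edges)
    \<comment> \<open>The other members of the group of \<open>C\<close>.\<close>
    define R where "R = {A \<in> ?S. min_cycle A = C} - {C}"
    have fR: "finite R" unfolding R_def by (rule finite_subset[OF _ fS]) blast
    have "q * card (hits A) \<le> card (hits C)" if "A \<in> R" for A
      using card_hits_not_forest[of A] that by (auto simp: R_def)
    then have "(\<Sum>A\<in>R. q * card (hits A)) \<le> of_nat (card R) * card (hits C)"
      by (rule sum_bounded_above)
    moreover have "card R \<le> card (Pow E)" using finite_E by (intro card_mono) (auto simp: R_def)
    then have "card R \<le> q" using q finite_E by (simp add: card_Pow)
    then have "of_nat (card R) * card (hits C) \<le> q * card (hits C)" by simp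
    ultimately have "q * (\<Sum>A\<in>R. card (hits A)) \<le> q * card (hits C)"
      unfolding sum_distrib_left by (rule order_trans)
    then have le: "(\<Sum>A\<in>R. card (hits A)) \<le> card (hits C)" using q_pos by simp
    have "- int (card (hits A)) \<le> ?g A" for A by (cases "even (card A)") auto
    then have "(\<Sum>A\<in>R. - int (card (hits A))) \<le> (\<Sum>A\<in>R. ?g A)" by (intro sum_mono)
    moreover have "(\<Sum>A\<in>R. - int (card (hits A))) = - int (\<Sum>A\<in>R. card (hits A))"
      by (simp add: sum_negf)
    ultimately have "- int (card (hits C)) \<le> (\<Sum>A\<in>R. ?g A)" using le by linarith
    moreover have "{A \<in> ?S. min_cycle A = C} = insert C R" "C \<notin> R" using C by (auto simp: R_def)
    then have "(\<Sum>A\<in>{A \<in> ?S. min_cycle A = C}. ?g A) = ?g C + (\<Sum>A\<in>R. ?g A)"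
      using sum.insert[OF fR, of C ?g] by simp
    ultimately show ?thesis using even by simp
  qed
  then have "0 \<le> (\<Sum>C\<in>min_cycle ` ?S. \<Sum>A\<in>{A \<in> ?S. min_cycle A = C}. ?g A)" by (rule sum_nonneg)
  also have "\<dots> = (\<Sum>A\<in>?S. ?g A)" by (rule sum.image_gen[OF fS, symmetric])
  finally show ?thesis using card_avoiders_split by simp
qed

end


section \<open>Components of a forest\<close>

lemma equiv_connected_in: "equiv (verts S) (connected_in S)"
proof (rule equivI)
  let ?r = "{(u, v). {u, v} \<in> edges S}"
  show "connected_in S \<subseteq> verts S \<times> verts S" by (auto simp: connected_in_def)
  show "refl_on (verts S) (connected_in S)" by (auto simp: refl_on_def connected_in_def)
  have "sym ?r" by (auto simp: sym_def insert_commute)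
  then have "sym (?r\<^sup>*)" by (rule sym_rtrancl)
  then show "sym (connected_in S)" by (auto simp: sym_def connected_in_def)
  show "trans (connected_in S)" by (auto simp: trans_def connected_in_def intro: rtrancl_trans)
qed

text \<open>Two-colorings that are constant along edges are the transversals hitting every edge when
  all matchings are the identity of a two-element set. There are \<open>2^c\<close> of them, where \<open>c\<close> is
  the number of components, and also \<open>2^(n - |E|)\<close> by \<open>card_hits_forest\<close>; comparing exponents
  gives the formula.\<close>

lemma card_components_forest:
  assumes S: "finite (verts S)" "\<And>e. e \<in> edges S \<Longrightarrow> e \<subseteq> verts S \<and> card e = 2"
    and forest: "forest (edges S)"
  shows "card (components S) + card (edges S) = card (verts S)"
proof -
  let ?V = "verts S" and ?E = "edges S" and ?R = "connected_in S"
  interpret matching_system ?V ?E 2 "\<lambda>_. UNIV :: bool set" "\<lambda>_. {{True}, {False}}"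
    using S by unfold_locales (auto simp: doubleton_eq_iff)
  have hits_iff: "s \<in> hits ?E \<longleftrightarrow> s \<in> extensional ?V \<and> (\<forall>x y. {x, y} \<in> ?E \<longrightarrow> s x = s y)" for s
  proof -
    have "s ` {x, y} \<in> {{True}, {False}} \<longleftrightarrow> s x = s y" for x y by auto
    moreover have "\<exists>x y. e = {x, y}" if "e \<in> ?E" for e using S(2)[OF that] by (metis card_2_iff)
    ultimately show ?thesis unfolding hits_def PiE_def Pi_UNIV mem_Collect_eq Int_UNIV_left by metis
  qed
  have eq: "equiv ?V ?R" by (rule equiv_connected_in)
  have fin: "finite (components S)"
    using S(1) by (auto simp: components_def quotient_def)
  have const: "s x = s y" if s: "s \<in> hits ?E" and xy: "(x, y) \<in> ?R" for s x y
  proof -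
    have "(x, y) \<in> {(u, v). {u, v} \<in> ?E}\<^sup>*" using xy by (simp add: connected_in_def)
    then show ?thesis
    proof (induction rule: rtrancl_induct)
      case (step y z)
      then have "s y = s z" using s unfolding hits_iff by blast
      then show ?case using step by simp
    qed simp
  qed
  let ?f = "\<lambda>F. restrict (\<lambda>v. v \<in> \<Union>F) ?V"
  have Union: "\<Union>F \<subseteq> ?V" if "F \<subseteq> components S" for F
    using that Union_quotient[OF eq] by (auto simp: components_def)
  have disj: "K = K'" if "K \<in> components S" "K' \<in> components S" "x \<in> K" "x \<in> K'" for K K' x
    using quotient_disj[OF eq, of K K'] that by (auto simp: components_def)
  have closed: "x \<in> \<Union>F \<longleftrightarrow> y \<in> \<Union>F" if F: "F \<subseteq> components S" and xy: "{x, y} \<in> ?E" for F x y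
  proof -
    have V: "x \<in> ?V" "y \<in> ?V" using S(2)[OF xy] by auto
    then have R: "(x, y) \<in> ?R" "(y, x) \<in> ?R"
      using xy by (auto simp: connected_in_def insert_commute)
    have "b \<in> K" if "(a, b) \<in> ?R" "K \<in> F" "a \<in> K" for a b K
      using in_quotient_imp_closed[OF eq, of K a b] that F by (auto simp: components_def)
    then show ?thesis using R by blast
  qed
  have "bij_betw ?f (Pow (components S)) (hits ?E)"
  proof (rule bij_betw_imageI)
    have subset: "F \<subseteq> F'"
      if F: "F \<subseteq> components S" "F' \<subseteq> components S" and eq_f: "?f F = ?f F'" for F F'
    proof
      fix K assume K: "K \<in> F"
      then have "K \<noteq> {}" using in_quotient_imp_non_empty[OF eq] F by (auto simp: components_def)
      then obtain x where x: "x \<in> K" by auto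
      then have "x \<in> ?V" using Union[OF F(1)] K by blast
      then have "x \<in> \<Union>F'" using fun_cong[OF eq_f, of x] x K by auto
      then obtain K' where "K' \<in> F'" "x \<in> K'" by blast
      then show "K \<in> F'" using disj[of K K' x] x K F by blast
    qed
    show "inj_on ?f (Pow (components S))"
    proof (rule inj_onI)
      fix F F' assume "F \<in> Pow (components S)" "F' \<in> Pow (components S)" "?f F = ?f F'"
      then show "F = F'" using subset[of F F'] subset[of F' F] by simp
    qed
    show "?f ` Pow (components S) = hits ?E"
    proof (intro equalityI subsetI)
      fix s assume "s \<in> ?f ` Pow (components S)"
      then obtain F where F: "F \<subseteq> components S" and s: "s = ?f F" by auto
      have "s x = s y" if xy: "{x, y} \<in> ?E" for x y
        using closed[OF F xy] S(2)[OF xy] by (simp add: s)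
      then show "s \<in> hits ?E" unfolding hits_iff by (simp add: s)
    next
      fix s assume s: "s \<in> hits ?E"
      let ?F = "{K \<in> components S. \<exists>v\<in>K. s v}"
      have "s v = ?f ?F v" for v
      proof (cases "v \<in> ?V")
        case True
        have "s v \<longleftrightarrow> v \<in> \<Union>?F"
        proof
          assume "s v"
          moreover have "?R `` {v} \<in> components S" using True by (simp add: components_def quotientI)
          moreover have "v \<in> ?R `` {v}" using True by (simp add: connected_in_def)
          ultimately show "v \<in> \<Union>?F" by blast
        next
          assume "v \<in> \<Union>?F"
          then obtain K w where K: "K \<in> components S" "w \<in> K" "v \<in> K" "s w" by auto
          then have "(w, v) \<in> ?R" using in_quotient_imp_in_rel[OF eq] by (auto simp: components_def)
          then show "s v" using const[OF s] K by metis
        qed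
        then show ?thesis using True by simp
      next
        case False
        moreover have "s \<in> extensional ?V" using s unfolding hits_iff by (rule conjunct1)
        ultimately have "s v = undefined" by (rule extensional_arb[rotated])
        then show ?thesis using False by simp
      qed
      then have "s = ?f ?F" by blast
      then show "s \<in> ?f ` Pow (components S)" by blast
    qed
  qed
  then have "card (hits ?E) = 2 ^ card (components S)"
    using bij_betw_same_card card_Pow[OF fin] by metis
  then have "2 ^ (card (components S) + card ?E) = (2 :: nat) ^ card ?V"
    using card_hits_forest[OF order_refl forest] by (simp add: power_add)
  then show ?thesis by simp
qed

section \<open>Colorings of a cover as transversals\<close>

lemma finite_edges: "simple_graph G \<Longrightarrow> finite (edges G)"
  by (rule finite_subset[of _ "Pow (verts G)"]) (auto simp: simple_graph_def)

text \<open>Cover edges exist only over edges of \<open>G\<close>, so a transversal is independent as soon as it hits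
  none of these.\<close>

lemma num_colorings_eq_card_transversals:
  assumes c: "is_cover G L H" and G: "simple_graph G"
  shows "num_colorings G L H = card {s \<in> PiE (verts G) L. \<forall>e\<in>edges G. s ` e \<notin> edges H}"
proof -
  let ?V = "verts G"
  let ?A = "{s \<in> PiE ?V L. \<forall>e\<in>edges G. s ` e \<notin> edges H}"
  have H: "simple_graph H" and vH: "verts H = (\<Union>v\<in>?V. L v)"
    and none: "\<And>u v. u \<in> ?V \<Longrightarrow> v \<in> ?V \<Longrightarrow> u \<noteq> v \<Longrightarrow> {u, v} \<notin> edges G \<Longrightarrow>
      edges_between H (L u) (L v) = {}"
    using c by (auto simp: is_cover_def)
  have disj: "u = v" if "u \<in> ?V" "v \<in> ?V" "x \<in> L u" "x \<in> L v" for u v x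
    using c that by (auto simp: is_cover_def disjoint_family_on_def)
  have inter: "s ` ?V \<inter> L v = {s v}" if "s \<in> PiE ?V L" "v \<in> ?V" for s v
    using that disj by (auto simp: PiE_iff)
  have indep: "independent H (s ` ?V) \<longleftrightarrow> (\<forall>e\<in>edges G. s ` e \<notin> edges H)" if s: "s \<in> PiE ?V L" for s
  proof
    assume ind: "independent H (s ` ?V)"
    show "\<forall>e\<in>edges G. s ` e \<notin> edges H"
    proof
      fix e assume "e \<in> edges G"
      then have "e \<subseteq> ?V" "card e = 2" using G by (auto simp: simple_graph_def)
      moreover from this obtain x y where "e = {x, y}" by (metis card_2_iff)
      ultimately show "s ` e \<notin> edges H" using ind by (simp add: independent_def)
    qed
  next
    assume av: "\<forall>e\<in>edges G. s ` e \<notin> edges H"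
    have "{s u, s v} \<notin> edges H" if uv: "u \<in> ?V" "v \<in> ?V" for u v
    proof
      assume e: "{s u, s v} \<in> edges H"
      then have "card {s u, s v} = 2" using H by (simp add: simple_graph_def)
      then have "u \<noteq> v" by auto
      moreover have "{s u, s v} \<in> edges_between H (L u) (L v)"
        using e s uv by (auto simp: edges_between_def)
      ultimately have "{u, v} \<in> edges G" using none uv by blast
      then show False using av e by force
    qed
    moreover have "s ` ?V \<subseteq> verts H" using s vH by auto
    ultimately show "independent H (s ` ?V)" by (auto simp: independent_def)
  qed
  have "bij_betw (\<lambda>s. s ` ?V) ?A {T. proper_coloring G L H T}"
  proof (rule bij_betw_imageI)
    show "inj_on (\<lambda>s. s ` ?V) ?A"
    proof (rule inj_onI)
      fix s t assume st: "s \<in> ?A" "t \<in> ?A" "s ` ?V = t ` ?V"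
      then have "s v = t v" if "v \<in> ?V" for v
        using inter[of s v] inter[of t v] that by auto
      then show "s = t" using st by (intro PiE_ext[of s ?V L t]) auto
    qed
    show "(\<lambda>s. s ` ?V) ` ?A = {T. proper_coloring G L H T}"
    proof (intro equalityI subsetI)
      fix T assume "T \<in> (\<lambda>s. s ` ?V) ` ?A"
      then obtain s where "s \<in> ?A" "T = s ` ?V" by auto
      then show "T \<in> {T. proper_coloring G L H T}"
        using indep[of s] inter[of s] by (auto simp: proper_coloring_def independent_def)
    next
      fix T assume "T \<in> {T. proper_coloring G L H T}"
      then have T: "T \<subseteq> verts H" "\<And>v. v \<in> ?V \<Longrightarrow> card (T \<inter> L v) = 1" "independent H T"
        by (auto simp: proper_coloring_def)
      then have "\<forall>v\<in>?V. \<exists>x. T \<inter> L v = {x}" by (metis card_1_singletonE)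
      then obtain s0 where s0: "\<And>v. v \<in> ?V \<Longrightarrow> T \<inter> L v = {s0 v}" by metis
      let ?s = "restrict s0 ?V"
      have "?s \<in> PiE ?V L" using s0 by auto
      moreover have "?s ` ?V = T" using s0 T(1) vH by fastforce
      ultimately show "T \<in> (\<lambda>s. s ` ?V) ` ?A" using indep[of ?s] T(3) by (intro image_eqI[of _ _ ?s]) auto
    qed
  qed
  then show ?thesis by (simp add: num_colorings_def bij_betw_same_card)
qed

section \<open>Covers of bipartite graphs from bijections\<close>

text \<open>Both covers in the proof, the extremal one and the completion of a given one, arise by
  choosing for every edge a bijection from the fiber over its end in \<open>X\<close> to the fiber over its
  other end. The bipartition serves to orient the edges.\<close>

locale bipartite_bijections =
  fixes V :: "'a set" and E :: "'a set set" and X :: "'a set" and q :: nat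
    and L :: "'a \<Rightarrow> 'b set" and \<phi> :: "'a set \<Rightarrow> 'b \<Rightarrow> 'b"
  assumes finite_verts: "finite V" and fold_pos: "0 < q"
    and edge_subset: "\<And>e. e \<in> E \<Longrightarrow> e \<subseteq> V \<and> card e = 2"
    and part: "\<And>u v. {u, v} \<in> E \<Longrightarrow> u \<in> X \<longleftrightarrow> v \<notin> X"
    and card_fiber: "\<And>v. v \<in> V \<Longrightarrow> card (L v) = q"
    and disj: "disjoint_family_on L V"
    and bij: "\<And>u v. {u, v} \<in> E \<Longrightarrow> u \<in> X \<Longrightarrow> bij_betw (\<phi> {u, v}) (L u) (L v)"
begin

definition M :: "'a set \<Rightarrow> 'b set set" where
  "M e = {{x, \<phi> e x} | x u. u \<in> e \<inter> X \<and> x \<in> L u}"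

lemma L_unique: "u \<in> V \<Longrightarrow> v \<in> V \<Longrightarrow> x \<in> L u \<Longrightarrow> x \<in> L v \<Longrightarrow> u = v"
  using disj by (auto simp: disjoint_family_on_def)

lemma edgeE:
  assumes "e \<in> E"
  obtains u v where "e = {u, v}" "u \<noteq> v" "u \<in> V" "v \<in> V" "u \<in> X" "v \<notin> X"
proof -
  obtain a b where ab: "e = {a, b}" "a \<noteq> b" using edge_subset[OF assms] by (metis card_2_iff)
  show thesis
    using that[of a b] that[of b a] part[of a b] edge_subset[OF assms] assms ab
    by (auto simp: insert_commute)
qed

lemma M_iff:
  assumes e: "{u, v} \<in> E" "u \<in> X" and xy: "x \<in> L u" "y \<in> L v"
  shows "{x, y} \<in> M {u, v} \<longleftrightarrow> y = \<phi> {u, v} x"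
proof -
  have uv: "u \<in> V" "v \<in> V" "v \<notin> X" "u \<noteq> v" using edge_subset[OF e(1)] part[OF e(1)] e(2) by auto
  then have "x = x'" "y = \<phi> {u, v} x'" if "{x, y} = {x', \<phi> {u, v} x'}" "x' \<in> L u" for x'
    using that xy L_unique[of u v] by (auto simp: doubleton_eq_iff)
  then show ?thesis using uv e xy unfolding M_def by blast
qed

sublocale matching_system V E q L M
proof
  fix u v x assume e: "{u, v} \<in> E" "u \<noteq> v" and x: "x \<in> L u"
  show "\<exists>!y. y \<in> L v \<and> {x, y} \<in> M {u, v}"
  proof (cases "u \<in> X")
    case True
    have "\<phi> {u, v} x \<in> L v" using bij_betwE[OF bij[OF e(1) True]] x by auto
    then show ?thesis using M_iff[OF e(1) True x] by auto
  next
    case False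
    have e': "{v, u} \<in> E" "v \<in> X" using e False part by (auto simp: insert_commute)
    have iff: "{x, y} \<in> M {u, v} \<longleftrightarrow> x = \<phi> {v, u} y" if "y \<in> L v" for y
      using M_iff[OF e' that x] by (simp add: insert_commute)
    have "\<exists>!y. y \<in> L v \<and> x = \<phi> {v, u} y"
      using bij[OF e'] x unfolding bij_betw_def inj_on_def by blast
    then show ?thesis using iff by blast
  qed
qed (use finite_verts fold_pos edge_subset card_fiber in auto)

definition cover_graph :: "'b ugraph" where
  "cover_graph = \<lparr>verts = (\<Union>v\<in>V. L v), edges = (\<Union>e\<in>E. M e)\<rparr>"

lemma cover_edgeE:
  assumes "f \<in> edges cover_graph"
  obtains u v x where "{u, v} \<in> E" "u \<noteq> v" "u \<in> V" "v \<in> V" "u \<in> X" "v \<notin> X"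
    "x \<in> L u" "\<phi> {u, v} x \<in> L v" "f = {x, \<phi> {u, v} x}" "f \<in> M {u, v}"
proof -
  obtain e where e: "e \<in> E" "f \<in> M e" using assms by (auto simp: cover_graph_def)
  obtain u v where uv: "e = {u, v}" "u \<noteq> v" "u \<in> V" "v \<in> V" "u \<in> X" "v \<notin> X"
    using edgeE[OF e(1)] .
  then obtain x where x: "x \<in> L u" "f = {x, \<phi> {u, v} x}" using e by (auto simp: M_def)
  have "\<phi> {u, v} x \<in> L v" using bij_betwE[OF bij[of u v]] e uv x by auto
  then show thesis using that uv e x by blast
qed

lemma cover_edge_iff:
  assumes "u \<in> V" "v \<in> V" "x \<in> L u" "y \<in> L v"
  shows "{x, y} \<in> edges cover_graph \<longleftrightarrow> {u, v} \<in> E \<and> {x, y} \<in> M {u, v}"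
proof
  assume "{x, y} \<in> edges cover_graph"
  then obtain a b z where ab: "{a, b} \<in> E" "a \<in> V" "b \<in> V" "z \<in> L a" "\<phi> {a, b} z \<in> L b"
    "{x, y} = {z, \<phi> {a, b} z}" "{x, y} \<in> M {a, b}" by (rule cover_edgeE)
  then have "(x = z \<and> y = \<phi> {a, b} z) \<or> (x = \<phi> {a, b} z \<and> y = z)" by (auto simp: doubleton_eq_iff)
  then have "{u, v} = {a, b}" using ab assms L_unique by (metis insert_commute)
  then show "{u, v} \<in> E \<and> {x, y} \<in> M {u, v}" using ab by simp
qed (auto simp: cover_graph_def)

lemma cover_graph_fold_cover:
  assumes G: "verts G = V" "edges G = E" and ne: "V \<noteq> {}"
  shows "is_fold_cover q G L cover_graph"
proof -
  have L_ne: "L v \<noteq> {}" if "v \<in> V" for v using card_L[OF that] q_pos by auto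
  have two: "f \<subseteq> verts cover_graph \<and> card f = 2" if f: "f \<in> edges cover_graph" for f
  proof -
    obtain u v x where "u \<noteq> v" "u \<in> V" "v \<in> V" "x \<in> L u" "\<phi> {u, v} x \<in> L v"
      "f = {x, \<phi> {u, v} x}" using f by (rule cover_edgeE)
    moreover from this have "x \<noteq> \<phi> {u, v} x" using L_unique by metis
    ultimately show ?thesis by (auto simp: cover_graph_def)
  qed
  have "simple_graph cover_graph"
    using two ne L_ne finite_V finite_L by (auto simp: simple_graph_def cover_graph_def)
  moreover have "independent cover_graph (L v)" if v: "v \<in> V" for v
  proof -
    have "{v, v} \<notin> E" using edge by fastforce
    then show ?thesis using cover_edge_iff[OF v v] v by (auto simp: independent_def cover_graph_def)
  qed
  moreover have "disjoint (edges_between cover_graph (L u) (L v))"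
    if uv: "u \<in> V" "v \<in> V" "u \<noteq> v" for u v
  proof (rule disjointI)
    fix f g assume "f \<in> edges_between cover_graph (L u) (L v)" "g \<in> edges_between cover_graph (L u) (L v)"
      and ne: "f \<noteq> g"
    then obtain x y x' y' where f: "f = {x, y}" "x \<in> L u" "y \<in> L v" "{x, y} \<in> edges cover_graph"
      and g: "g = {x', y'}" "x' \<in> L u" "y' \<in> L v" "{x', y'} \<in> edges cover_graph"
      by (auto simp: edges_between_def)
    have e: "{u, v} \<in> E" "{v, u} \<in> E"
      and M: "{x, y} \<in> M {u, v}" "{x', y'} \<in> M {u, v}" "{y, x} \<in> M {v, u}" "{y', x'} \<in> M {v, u}"
      using f g cover_edge_iff uv by (auto simp: insert_commute)
    have "x = x' \<Longrightarrow> y = y'" using perfect[OF e(1) uv(3) f(2)] M f g by blast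
    moreover have "y = y' \<Longrightarrow> x = x'" using perfect[OF e(2) _ f(3)] uv(3) M f g by blast
    moreover have "x \<noteq> y'" "y \<noteq> x'" using f g uv L_unique by blast+
    ultimately show "f \<inter> g = {}" using f g ne by auto
  qed
  moreover have "edges_between cover_graph (L u) (L v) = {}"
    if "u \<in> V" "v \<in> V" "{u, v} \<notin> E" for u v
    using that cover_edge_iff by (auto simp: edges_between_def)
  ultimately show ?thesis
    using disj card_L by (simp add: is_fold_cover_def is_cover_def G) (simp add: cover_graph_def)
qed

lemma num_colorings_cover_graph:
  assumes G: "verts G = V" "edges G = E" and ne: "V \<noteq> {}"
  shows "num_colorings G L cover_graph = card avoiders"
proof -
  have "simple_graph G" using G ne finite_V edge by (auto simp: simple_graph_def)
  moreover have "is_cover G L cover_graph" using cover_graph_fold_cover[OF assms] by (simp add: is_fold_cover_def)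
  moreover have "s ` e \<in> edges cover_graph \<longleftrightarrow> s ` e \<in> M e" if s: "s \<in> PiE V L" and e: "e \<in> E" for s e
  proof -
    obtain u v where uv: "e = {u, v}" "u \<in> V" "v \<in> V" using edgeE[OF e] by metis
    then show ?thesis using cover_edge_iff[of u v "s u" "s v"] s e by auto
  qed
  ultimately show ?thesis
    using num_colorings_eq_card_transversals[of G L cover_graph]
    by (auto simp: G avoiders_def intro!: arg_cong[where f = card])
qed

end

section \<open>The lower bound\<close>

text \<open>The unmatched parts of both sides have the same size, so any bijection between them
  completes the matching.\<close>

lemma extend_partial_matching:
  assumes fin: "finite A" "finite B" "card A = card B"
    and R: "\<And>x y y'. x \<in> A \<Longrightarrow> y \<in> B \<Longrightarrow> y' \<in> B \<Longrightarrow> R x y \<Longrightarrow> R x y' \<Longrightarrow> y = y'"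
      "\<And>x x' y. x \<in> A \<Longrightarrow> x' \<in> A \<Longrightarrow> y \<in> B \<Longrightarrow> R x y \<Longrightarrow> R x' y \<Longrightarrow> x = x'"
  obtains f where "bij_betw f A B" "\<And>x y. x \<in> A \<Longrightarrow> y \<in> B \<Longrightarrow> R x y \<Longrightarrow> y = f x"
proof -
  define D where "D = {x \<in> A. \<exists>y\<in>B. R x y}"
  define g where "g x = (SOME y. y \<in> B \<and> R x y)" for x
  have g: "g x \<in> B" "R x (g x)" if "x \<in> D" for x
    using that someI_ex[of "\<lambda>y. y \<in> B \<and> R x y"] by (auto simp: D_def g_def)
  have DA: "D \<subseteq> A" by (auto simp: D_def)
  have inj: "inj_on g D"
    by (rule inj_onI) (metis DA R(2) g subsetD)
  then have bg: "bij_betw g D (g ` D)" by (simp add: bij_betw_def)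
  have gB: "g ` D \<subseteq> B" using g by auto
  have "card (A - D) = card (B - g ` D)"
    using fin DA gB card_image[OF inj] by (metis card_Diff_subset finite_subset)
  then obtain h where bh: "bij_betw h (A - D) (B - g ` D)"
    using fin by (metis finite_Diff finite_same_card_bij)
  let ?f = "\<lambda>x. if x \<in> D then g x else h x"
  have "bij_betw ?f (D \<union> (A - D)) (g ` D \<union> (B - g ` D))"
    using bij_betw_disjoint_Un[OF bg bh] by auto
  then have "bij_betw ?f A B" using DA gB by (simp add: Un_absorb1)
  moreover have "y = ?f x" if "x \<in> A" "y \<in> B" "R x y" for x y
    using that R(1) g by (auto simp: D_def)
  ultimately show thesis using that by blast
qed

text \<open>The given matchings are completed to perfect ones. More cover edges mean fewer colorings, so
  the bound for perfect matchings carries over.\<close>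

lemma forest_sum_le_num_colorings:
  assumes G: "simple_graph G" and part: "\<And>u v. {u, v} \<in> edges G \<Longrightarrow> u \<in> X \<longleftrightarrow> v \<notin> X"
    and c: "is_fold_cover q G L H" and q: "2 ^ card (edges G) \<le> q"
  shows "(\<Sum>A | A \<subseteq> edges G \<and> forest A. (- 1) ^ card A * int q ^ (card (verts G) - card A))
    \<le> int (num_colorings G L H)"
proof -
  let ?V = "verts G" and ?E = "edges G"
  have edge: "e \<subseteq> ?V \<and> card e = 2" if "e \<in> ?E" for e using that G by (auto simp: simple_graph_def)
  have cov: "is_cover G L H" and card_L: "\<And>v. v \<in> ?V \<Longrightarrow> card (L v) = q"
    using c by (auto simp: is_fold_cover_def)
  have disj: "disjoint_family_on L ?V" using cov by (simp add: is_cover_def)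
  have q0: "0 < q" using q by (meson less_le_trans zero_less_numeral zero_less_power)
  have fin_L: "finite (L v)" if "v \<in> ?V" for v using card_L[OF that] q0 by (metis card.infinite less_irrefl)
  let ?Q = "\<lambda>e f. \<forall>u v. e = {u, v} \<longrightarrow> u \<in> X \<longrightarrow>
    bij_betw f (L u) (L v) \<and> (\<forall>x\<in>L u. \<forall>y\<in>L v. {x, y} \<in> edges H \<longrightarrow> y = f x)"
  have "\<exists>f. ?Q e f" if e: "e \<in> ?E" for e
  proof -
    obtain a b where "e = {a, b}" "a \<noteq> b" using edge[OF e] by (metis card_2_iff)
    then obtain u v where uv: "e = {u, v}" "u \<in> X" "v \<notin> X" "u \<noteq> v"
      using part[of a b] e by (metis insert_commute)
    have V: "u \<in> ?V" "v \<in> ?V" using uv edge[OF e] by auto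
    have dis: "L u \<inter> L v = {}" using disj V uv by (simp add: disjoint_family_on_def)
    have match: "disjoint (edges_between H (L u) (L v))" using cov V uv by (simp add: is_cover_def)
    have same: "{x, y} = {x', y'}"
      if "x \<in> L u" "y \<in> L v" "x' \<in> L u" "y' \<in> L v" "{x, y} \<in> edges H" "{x', y'} \<in> edges H"
        "x = x' \<or> y = y'" for x y x' y'
    proof (rule ccontr)
      assume "{x, y} \<noteq> {x', y'}"
      moreover have "{x, y} \<in> edges_between H (L u) (L v)" "{x', y'} \<in> edges_between H (L u) (L v)"
        using that by (auto simp: edges_between_def)
      ultimately have "{x, y} \<inter> {x', y'} = {}" using match by (auto dest: disjointD)
      then show False using that by auto
    qed
    obtain f where f: "bij_betw f (L u) (L v)"
      "\<And>x y. x \<in> L u \<Longrightarrow> y \<in> L v \<Longrightarrow> {x, y} \<in> edges H \<Longrightarrow> y = f x"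
    proof (rule extend_partial_matching[of "L u" "L v" "\<lambda>x y. {x, y} \<in> edges H"])
      show "finite (L u)" "finite (L v)" "card (L u) = card (L v)" using fin_L card_L V by auto
      show "y = y'" if "x \<in> L u" "y \<in> L v" "y' \<in> L v" "{x, y} \<in> edges H" "{x, y'} \<in> edges H" for x y y'
        using same[of x y x y'] that by (auto simp: doubleton_eq_iff)
      show "x = x'" if "x \<in> L u" "x' \<in> L u" "y \<in> L v" "{x, y} \<in> edges H" "{x', y} \<in> edges H" for x x' y
        using same[of x y x' y] that by (auto simp: doubleton_eq_iff)
    qed blast
    have "?Q e f"
    proof (intro allI impI)
      fix u' v' assume "e = {u', v'}" "u' \<in> X"
      then have "u' = u" "v' = v" using uv by (auto simp: doubleton_eq_iff)
      then show "bij_betw f (L u') (L v') \<and> (\<forall>x\<in>L u'. \<forall>y\<in>L v'. {x, y} \<in> edges H \<longrightarrow> y = f x)"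
        using f by blast
    qed
    then show ?thesis by blast
  qed
  then obtain \<phi> where \<phi>: "\<And>e. e \<in> ?E \<Longrightarrow> ?Q e (\<phi> e)" by metis
  interpret bipartite_bijections ?V ?E X q L \<phi>
  proof
    show "finite ?V" using G by (simp add: simple_graph_def)
  qed (use q0 edge part card_L disj \<phi> in auto)
  have "avoiders \<subseteq> {s \<in> PiE ?V L. \<forall>e\<in>?E. s ` e \<notin> edges H}"
  proof -
    have "s ` e \<in> M e" if s: "s \<in> PiE ?V L" and e: "e \<in> ?E" and H: "s ` e \<in> edges H" for s e
    proof -
      obtain u v where uv: "e = {u, v}" "u \<in> ?V" "v \<in> ?V" "u \<in> X" using edgeE[OF e] by metis
      have "s u \<in> L u" "s v \<in> L v" using s uv by auto
      then show ?thesis using \<phi>[OF e] M_iff[of u v "s u" "s v"] e H uv by auto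
    qed
    then show ?thesis by (auto simp: avoiders_def)
  qed
  then have "card avoiders \<le> num_colorings G L H"
    unfolding num_colorings_eq_card_transversals[OF cov G]
    using finite_PiE_L by (intro card_mono) auto
  then show ?thesis
    using forest_sum_le_avoiders[OF part q] by (simp add: forest_sum_def)
qed

section \<open>The upper bound\<close>

lemma bij_betw_add_mod:
  assumes "0 < (q :: nat)"
  shows "bij_betw (\<lambda>i. (i + c) mod q) {..<q} {..<q}"
proof -
  have "inj_on (\<lambda>i. (i + c) mod q) {..<q}"
  proof (rule inj_onI)
    fix i j assume ij: "i \<in> {..<q}" "j \<in> {..<q}" "(i + c) mod q = (j + c) mod q"
    then have "[i + c = j + c] (mod q)" by (simp add: cong_def)
    then have "[i = j] (mod q)" by (simp add: cong_add_rcancel_nat)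
    then show "i = j" using ij by (simp add: cong_def)
  qed
  moreover have "(\<lambda>i. (i + c) mod q) ` {..<q} \<subseteq> {..<q}" using assms by auto
  ultimately show ?thesis
    by (simp add: bij_betw_def endo_inj_surj)
qed

lemma bij_betw_singleton_Times:
  assumes "bij_betw f A B"
  shows "bij_betw (\<lambda>x. (v, f (snd x))) ({u} \<times> A) ({v} \<times> B)"
proof (rule bij_betw_imageI)
  show "inj_on (\<lambda>x. (v, f (snd x))) ({u} \<times> A)"
    using bij_betw_imp_inj_on[OF assms] by (auto simp: inj_on_def)
  have "(\<lambda>x. (v, f (snd x))) ` ({u} \<times> A) = Pair v ` f ` A" by force
  then show "(\<lambda>x. (v, f (snd x))) ` ({u} \<times> A) = {v} \<times> B"
    using bij_betw_imp_surj_on[OF assms] by auto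
qed

text \<open>Sums of distinct powers of two are the codes \<open>set_encode P\<close> of finite sets, whose
  injectivity is the uniqueness of binary expansions.\<close>

lemma set_encode_less_power:
  assumes "P \<subseteq> {..<m}"
  shows "set_encode P < 2 ^ m"
proof -
  have "set_encode P \<le> (\<Sum>i<m. 2 ^ i)"
    unfolding set_encode_def using assms by (intro sum_mono2) auto
  also have "\<dots> < (2 :: nat) ^ m" by (induction m) auto
  finally show ?thesis .
qed

text \<open>On an even cycle whose edge weights are sums of vertex weights, the even-indexed and the
  odd-indexed edges each cover every vertex once, so both classes sum to the total vertex
  weight.\<close>

lemma alternate_edge_sums_cong:
  fixes g w :: "nat \<Rightarrow> int"
  assumes "\<And>i. i < 2 * l \<Longrightarrow> [w i = g i + g (Suc i mod (2 * l))] (mod r)"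
  shows "[(\<Sum>j<l. w (2 * j)) = (\<Sum>j<l. w (2 * j + 1))] (mod r)"
proof -
  let ?k = "2 * l"
  define h where "h i = g (i mod ?k)" for i
  have w: "[w i = h i + h (Suc i)] (mod r)" if "i < ?k" for i
    using assms[OF that] that by (simp add: h_def)
  have even: "(\<Sum>j<n. h (2 * j) + h (Suc (2 * j))) = (\<Sum>i<2 * n. h i)" for n
    by (induction n) auto
  have odd: "(\<Sum>j<n. h (2 * j + 1) + h (Suc (2 * j + 1))) = (\<Sum>i<2 * n. h i) + h (2 * n) - h 0" for n
    by (induction n) auto
  have "[(\<Sum>j<l. w (2 * j)) = (\<Sum>j<l. h (2 * j) + h (Suc (2 * j)))] (mod r)"
    by (intro cong_sum w) auto
  moreover have "[(\<Sum>j<l. w (2 * j + 1)) = (\<Sum>j<l. h (2 * j + 1) + h (Suc (2 * j + 1)))] (mod r)"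
    by (intro cong_sum w) auto
  moreover have "h ?k = h 0" by (simp add: h_def)
  ultimately show ?thesis using even odd by (metis add_diff_cancel_right' cong_sym cong_trans)
qed

text \<open>The extremal cover: the fibers are copies of \<open>{..<q}\<close>, and the edge with number \<open>w e\<close>
  shifts by \<open>2^(w e)\<close> modulo \<open>q\<close>, oriented away from \<open>X\<close>. Distinct shifts \<open>2^i\<close> keep the
  shifts of a cycle from cancelling, so only forests can be hit entirely.\<close>

lemma num_colorings_eq_forest_sum:
  fixes G :: "'a ugraph"
  assumes G: "simple_graph G" and part: "\<And>u v. {u, v} \<in> edges G \<Longrightarrow> u \<in> X \<longleftrightarrow> v \<notin> X"
    and q: "2 ^ card (edges G) \<le> q"
  shows "\<exists>(L :: 'a \<Rightarrow> ('a \<times> nat) set) H. is_fold_cover q G L H \<and>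
    int (num_colorings G L H) =
      (\<Sum>A | A \<subseteq> edges G \<and> forest A. (- 1) ^ card A * int q ^ (card (verts G) - card A))"
proof -
  let ?V = "verts G" and ?E = "edges G"
  have edge: "e \<subseteq> ?V \<and> card e = 2" if "e \<in> ?E" for e using that G by (auto simp: simple_graph_def)
  have finV: "finite ?V" "?V \<noteq> {}" using G by (auto simp: simple_graph_def)
  have finE: "finite ?E" using G by (rule finite_edges)
  have q0: "0 < q" using q by (meson less_le_trans zero_less_numeral zero_less_power)
  obtain w where w: "bij_betw w ?E {..<card ?E}"
    using ex_bij_betw_finite_nat[OF finE] by (auto simp: atLeast0LessThan)
  let ?L = "\<lambda>v. {v} \<times> {..<q}"
  \<comment> \<open>The end of \<open>e\<close> outside \<open>X\<close> is the only element of \<open>e - X\<close>.\<close>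
  let ?\<phi> = "\<lambda>e (x :: 'a \<times> nat). (the_elem (e - X), (snd x + 2 ^ w e) mod q)"
  have head: "the_elem ({u, v} - X) = v" if "{u, v} \<in> ?E" "u \<in> X" for u v
  proof -
    have "{u, v} - X = {v}" using part[OF that(1)] that(2) by auto
    then show ?thesis by simp
  qed
  interpret bipartite_bijections ?V ?E X q ?L ?\<phi>
  proof
    fix u v assume e: "{u, v} \<in> ?E" "u \<in> X"
    have "bij_betw (\<lambda>i. (i + 2 ^ w {u, v}) mod q) {..<q} {..<q}" using q0 by (rule bij_betw_add_mod)
    then show "bij_betw (?\<phi> {u, v}) (?L u) (?L v)"
      unfolding head[OF e] by (rule bij_betw_singleton_Times)
  qed (use finV q0 edge part in \<open>auto simp: disjoint_family_on_def\<close>)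
  have "hits A = {}" if A: "A \<subseteq> ?E" "\<not> forest A" for A
  proof (rule ccontr)
    assume "hits A \<noteq> {}"
    then obtain s where s: "s \<in> PiE ?V ?L" "\<And>e. e \<in> A \<Longrightarrow> s ` e \<in> M e" by (auto simp: hits_def)
    obtain vs where vs: "3 \<le> length vs" "distinct vs" "cycle_edges vs \<subseteq> A"
      using A(2) unfolding forest_def by blast
    obtain l where l: "length vs = 2 * l"
      using even_cycle[where vs = vs, OF part] vs A(1) by (metis evenE order_trans)
    have l0: "0 < l" using vs l by auto
    let ?e = "\<lambda>i. {vs ! i, vs ! (Suc i mod (2 * l))}"
    have eA: "?e i \<in> A" if "i < 2 * l" for i using vs(3) that l by (auto simp: cycle_edges_def)
    have inj: "?e i = ?e j \<longleftrightarrow> i = j" if "i < 2 * l" "j < 2 * l" for i j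
      using inj_on_eq_iff[OF inj_on_cycle_edges[OF vs(1,2)]] that l by auto
    have injw: "w (?e i) = w (?e j) \<longleftrightarrow> i = j" if "i < 2 * l" "j < 2 * l" for i j
      using inj[OF that] eA that A(1) bij_betw_imp_inj_on[OF w] by (metis inj_on_eq_iff subsetD)
    \<comment> \<open>With this sign the shift along an edge becomes the sum of the values at its ends, in whichever direction the cycle runs through it.\<close>
    define c where "c v = (if v \<in> X then - int (snd (s v)) else int (snd (s v)))" for v
    have oriented: "[2 ^ w {u, v} = c u + c v] (mod int q)" if e: "{u, v} \<in> A" "u \<in> X" for u v
    proof -
      have E: "{u, v} \<in> ?E" using e A by auto
      then have V: "u \<in> ?V" "v \<in> ?V" "v \<notin> X" using edge[OF E] part[OF E] e by auto
      have "{s u, s v} \<in> M {u, v}" using s(2)[OF e(1)] by simp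
      then have "s v = ?\<phi> {u, v} (s u)"
        using M_iff[OF E e(2) PiE_mem[OF s(1) V(1)] PiE_mem[OF s(1) V(2)]] by (rule iffD1[rotated])
      then have "snd (s v) = (snd (s u) + 2 ^ w {u, v}) mod q" by (metis snd_conv)
      then have "int (snd (s v)) = (int (snd (s u)) + 2 ^ w {u, v}) mod int q"
        by (simp add: zmod_int)
      then have "[int (snd (s v)) = int (snd (s u)) + 2 ^ w {u, v}] (mod int q)"
        by (simp add: cong_def)
      then have "[int (snd (s v)) - int (snd (s u)) = 2 ^ w {u, v}] (mod int q)"
        by (simp add: cong_iff_dvd_diff algebra_simps)
      then show ?thesis using V e by (simp add: c_def cong_sym_eq)
    qed
    have cong: "[2 ^ w (?e i) = c (vs ! i) + c (vs ! (Suc i mod (2 * l)))] (mod int q)"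
      if i: "i < 2 * l" for i
    proof (cases "vs ! i \<in> X")
      case True
      then show ?thesis using oriented eA[OF i] by blast
    next
      case False
      then have "vs ! (Suc i mod (2 * l)) \<in> X" using part eA[OF i] A(1) by blast
      then show ?thesis
        using oriented[of "vs ! (Suc i mod (2 * l))" "vs ! i"] eA[OF i]
        by (simp add: insert_commute add.commute)
    qed
    define W where "W i = w (?e i)" for i
    have injW: "W i = W j \<longleftrightarrow> i = j" if "i < 2 * l" "j < 2 * l" for i j
      unfolding W_def using that by (rule injw)
    have W_less: "W i \<in> {..<card ?E}" if "i < 2 * l" for i
      unfolding W_def using bij_betwE[OF w] eA[OF that] A(1) by blast
    define P where "P = (\<lambda>j. W (2 * j)) ` {..<l}"
    define N where "N = (\<lambda>j. W (2 * j + 1)) ` {..<l}"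
    have "inj_on (\<lambda>j. W (2 * j)) {..<l}" "inj_on (\<lambda>j. W (2 * j + 1)) {..<l}"
      by (auto intro!: inj_onI simp: injW)
    then have enc: "int (set_encode P) = (\<Sum>j<l. 2 ^ W (2 * j))"
      "int (set_encode N) = (\<Sum>j<l. 2 ^ W (2 * j + 1))"
      by (simp_all add: P_def N_def set_encode_def sum.reindex)
    have "[(\<Sum>j<l. 2 ^ W (2 * j)) = (\<Sum>j<l. 2 ^ W (2 * j + 1) :: int)] (mod int q)"
      unfolding W_def by (rule alternate_edge_sums_cong[where g = "\<lambda>i. c (vs ! i)"]) (rule cong)
    then have enc_cong: "[set_encode P = set_encode N] (mod q)"
      unfolding enc[symmetric] by (simp only: cong_int_iff)
    have "P \<subseteq> {..<card ?E}" "N \<subseteq> {..<card ?E}"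
      unfolding P_def N_def by (intro image_subsetI W_less; simp)+
    then have "set_encode P < q" "set_encode N < q"
      using set_encode_less_power q by (meson less_le_trans)+
    then have "set_encode P = set_encode N" using enc_cong by (simp add: cong_def)
    then have "P = N" by (simp add: set_encode_eq P_def N_def)
    moreover have "W (2 * 0) \<in> P" using l0 unfolding P_def by blast
    ultimately obtain j where j: "j < l" "W (2 * 0) = W (2 * j + 1)" unfolding N_def by blast
    then have "2 * 0 = 2 * j + 1" using injW[of "2 * 0" "2 * j + 1"] l0 by linarith
    then show False by simp
  qed
  then have "int (card avoiders) = forest_sum" by (simp add: card_avoiders_split)
  then have "int (num_colorings G ?L cover_graph) = forest_sum"
    using num_colorings_cover_graph finV by simp
  moreover have "is_fold_cover q G ?L cover_graph" using cover_graph_fold_cover finV by simp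
  ultimately show ?thesis unfolding forest_sum_def by blast
qed

section \<open>The DP color function\<close>

text \<open>Spanning subgraphs correspond to edge sets, and a forest with \<open>j\<close> edges has \<open>n - j\<close>
  components; at least one component exists, whence \<open>j \<le> n - 1\<close>.\<close>

lemma forest_sum_by_components:
  fixes G :: "'a ugraph"
  assumes G: "simple_graph G"
    and a: "\<And>i. a i = card {S. spanning_subgraph S G \<and> acyclic_graph S \<and> card (components S) = i}"
  shows "(\<Sum>A | A \<subseteq> edges G \<and> forest A. (- 1) ^ card A * x ^ (card (verts G) - card A)) =
    (\<Sum>j = 0..card (verts G) - 1. (- 1) ^ j * int (a (card (verts G) - j)) * x ^ (card (verts G) - j))"
proof -
  let ?V = "verts G" and ?E = "edges G" and ?n = "card (verts G)"
  let ?F = "{A. A \<subseteq> ?E \<and> forest A}"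
  have edge: "e \<subseteq> ?V \<and> card e = 2" if "e \<in> ?E" for e using that G by (auto simp: simple_graph_def)
  have finV: "finite ?V" "?V \<noteq> {}" using G by (auto simp: simple_graph_def)
  have finE: "finite ?E" using G by (rule finite_edges)
  have finF: "finite ?F" using finE by simp
  let ?S = "\<lambda>A. \<lparr>verts = ?V, edges = A\<rparr>"
  have comp: "card (components (?S A)) + card A = ?n" if "A \<in> ?F" for A
    using card_components_forest[of "?S A"] that edge finV by auto
  have small: "card A < ?n" if "A \<in> ?F" for A
  proof -
    have "components (?S A) \<noteq> {}" using finV by (auto simp: components_def quotient_def)
    moreover have "finite (components (?S A))"
      using finV(1) by (auto simp: components_def quotient_def)
    ultimately have "0 < card (components (?S A))" by (simp add: card_gt_0_iff)
    then show ?thesis using comp[OF that] by linarith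
  qed
  have a_eq: "a (?n - j) = card {A \<in> ?F. card A = j}" if j: "j \<in> {0..?n - 1}" for j
  proof -
    have jn: "j < ?n" using j finV by (metis One_nat_def Suc_pred atLeastAtMost_iff card_gt_0_iff le_imp_less_Suc)
    have "{S. spanning_subgraph S G \<and> acyclic_graph S \<and> card (components S) = ?n - j} =
        ?S ` {A \<in> ?F. card A = j}"
    proof (intro equalityI subsetI)
      fix S assume S: "S \<in> {S. spanning_subgraph S G \<and> acyclic_graph S \<and> card (components S) = ?n - j}"
      then have eq: "S = ?S (edges S)" by (cases S) (simp add: spanning_subgraph_def)
      have F: "edges S \<in> ?F" using S by (auto simp: spanning_subgraph_def acyclic_graph_iff_forest)
      have "card (components (?S (edges S))) = ?n - j" using S eq by simp
      then have "card (edges S) = j" using comp[OF F] jn by linarith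
      then show "S \<in> ?S ` {A \<in> ?F. card A = j}" using eq F by blast
    next
      fix S assume "S \<in> ?S ` {A \<in> ?F. card A = j}"
      then obtain A where A: "A \<in> ?F" "card A = j" "S = ?S A" by auto
      then show "S \<in> {S. spanning_subgraph S G \<and> acyclic_graph S \<and> card (components S) = ?n - j}"
        using comp[OF A(1)] by (auto simp: spanning_subgraph_def acyclic_graph_iff_forest)
    qed
    moreover have "inj_on ?S {A \<in> ?F. card A = j}" by (auto intro: inj_onI)
    ultimately show ?thesis by (simp add: a card_image)
  qed
  have "card ` ?F \<subseteq> {0..?n - 1}"
  proof (rule image_subsetI)
    fix A assume "A \<in> ?F"
    then have "card A < ?n" by (rule small)
    then show "card A \<in> {0..?n - 1}" by simp
  qed
  then have "(\<Sum>A\<in>?F. (- 1) ^ card A * x ^ (?n - card A)) =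
      (\<Sum>j = 0..?n - 1. \<Sum>A\<in>{A \<in> ?F. card A = j}. (- 1) ^ card A * x ^ (?n - card A))"
    by (rule sum.group[symmetric, OF finF finite_atLeastAtMost])
  also have "\<dots> = (\<Sum>j = 0..?n - 1. (- 1) ^ j * int (a (?n - j)) * x ^ (?n - j))"
  proof (rule sum.cong[OF refl])
    fix j assume j: "j \<in> {0..?n - 1}"
    have "(\<Sum>A\<in>{A \<in> ?F. card A = j}. (- 1) ^ card A * x ^ (?n - card A)) =
        (\<Sum>A\<in>{A \<in> ?F. card A = j}. (- 1) ^ j * x ^ (?n - j))"
      by (rule sum.cong) simp_all
    also have "\<dots> = (- 1) ^ j * int (a (?n - j)) * x ^ (?n - j)"
      unfolding a_eq[OF j] sum_constant by (simp only: mult_ac of_nat_id)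
    finally show "(\<Sum>A\<in>{A \<in> ?F. card A = j}. (- 1) ^ card A * x ^ (?n - card A)) =
        (- 1) ^ j * int (a (?n - j)) * x ^ (?n - j)" .
  qed
  finally show ?thesis .
qed

theorem theorem3:
  fixes G :: "'a ugraph" and n m q :: nat and a :: "nat \<Rightarrow> nat"
  assumes "simple_graph G" and "bipartite G"
    and "card (verts G) = n" and "card (edges G) = m"
    and "q \<ge> 1" and "q \<ge> m + 2 ^ m"
    and "\<And>i. a i = card {S. spanning_subgraph S G \<and> acyclic_graph S \<and> card (components S) = i}"
  shows "int (DP_color_function G q) =
    (\<Sum>j = 0..n - 1. (- 1) ^ j * int (a (n - j)) * int q ^ (n - j))"
proof -
  let ?F = "\<Sum>A | A \<subseteq> edges G \<and> forest A. (- 1) ^ card A * int q ^ (card (verts G) - card A)"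
  have q: "2 ^ card (edges G) \<le> q" using assms by simp
  obtain X Y where XY: "X \<inter> Y = {}" "\<forall>e\<in>edges G. \<exists>x\<in>X. \<exists>y\<in>Y. e = {x, y}"
    using assms(2) unfolding bipartite_def by blast
  have part: "u \<in> X \<longleftrightarrow> v \<notin> X" if uv: "{u, v} \<in> edges G" for u v
  proof -
    obtain x y where "x \<in> X" "y \<in> Y" "{u, v} = {x, y}" using XY(2) uv by blast
    then show ?thesis using XY(1) by (auto simp: doubleton_eq_iff)
  qed
  obtain L :: "'a \<Rightarrow> nat set" and H
    where LH: "is_fold_cover q G L H" "DP_color_function G q = num_colorings G L H"
    using DP_color_function_attained[OF assms(1,5)] by blast
  have "?F \<le> int (DP_color_function G q)"
    using forest_sum_le_num_colorings[OF assms(1) part LH(1) q] LH(2) by simp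
  moreover obtain L' :: "'a \<Rightarrow> ('a \<times> nat) set" and H'
    where "is_fold_cover q G L' H'" "int (num_colorings G L' H') = ?F"
    using num_colorings_eq_forest_sum[OF assms(1) part q] by blast
  then have "int (DP_color_function G q) \<le> ?F" using DP_color_function_le[of q G L' H'] by simp
  ultimately have "int (DP_color_function G q) = ?F" by simp
  also have "\<dots> = (\<Sum>j = 0..n - 1. (- 1) ^ j * int (a (n - j)) * int q ^ (n - j))"
    using forest_sum_by_components[OF assms(1,7)] assms(3) by simp
  finally show ?thesis .
qed

end
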